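(* Let $\mathbf{C}$ be a quasitopos and let $\rho$ be a canonical PBPO rule with type morphism $t_L:L\to L'$. Then $$\Rightarrow^{\rho}_{\mathrm{PBPO}} \;=\; \bigcup_{\tau\in\mathrm{compact}(\rho)}\Rightarrow^{\tau}_{\mathrm{PBPO}^+}.$$
   Context: A quasitopos is a category with all finite limits and colimits that is locally cartesian closed and has a regular-subobject classifier; in it every morphism factors as an epimorphism followed by a regular monomorphism. Hooked arrows denote regular monos. PBPO rule $\rho$: spans $L\xleftarrow{l}K\xrightarrow{r}R$ and $L'\xleftarrow{l'}K'\xrightarrow{r'}R'$ with $t_L:L\to L'$, $t_K:K\to K'$, $t_R:R\to R'$ such that $t_Ll=l't_K$ and $t_Rr=r't_K$; canonical if the left square is a pullback and the right square a pushout. PBPO step $G_L\Rightarrow^{\rho}_{\mathrm{PBPO}}G_R$: there exist $m:L\to G_L$, $\alpha:G_L\to L'$ with $t_L=\alpha\circ m$, a pullback $G_L\xleftarrow{g_L}G_K\xrightarrow{u'}K'$ of $G_L\xrightarrow{\alpha}L'\xleftarrow{l'}K'$, the induced $u:K\to G_K$ with $g_Lu=ml$, $u'u=t_K$, and a pushout $G_R$ of $G_K\xleftarrow{u}K\xrightarrow{r}R$. PBPO$^+$ rule $\tau$: $l:K\to L$, $r:K\to R$, $t_L:L\to L'$, $t_K:K\to K'$, $l':K'\to L'$ with $t_L l=l't_K$ a pullback. PBPO$^+$ step $G_L\Rightarrow^{\tau}_{\mathrm{PBPO}^+}G_R$: there exist $m:L\to G_L$, $\alpha:G_L\to L'$ with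 $\alpha m=t_L$ and $L\xleftarrow{1_L}L\xrightarrow{m}G_L$ a pullback of $L\xrightarrow{t_L}L'\xleftarrow{\alpha}G_L$; a pullback $G_L\xleftarrow{g_L}G_K\xrightarrow{u'}K'$ of $\alpha,l'$; $u:K\to G_K$ the unique morphism with $u'u=t_K$; and a pushout $G_R$ of $G_K\xleftarrow{u}K\xrightarrow{r}R$. rm-materialization of $f:A\to B$: a factorization $A\xrightarrow{f'}F\xrightarrow{f''}B$ with $f'$ a regular mono such that for every factorization $A\xrightarrow{m}C\xrightarrow{\alpha}B$ of $f$ with $m$ a regular mono there is a unique $\beta:C\to F$ with $f''\beta=\alpha$ and the square $\beta\circ m=f'\circ 1_A$ a pullback. (These exist in any quasitopos.) Compacted rule: for a canonical PBPO rule $\rho$ and a factorization $t_L=f\circ e$ with $e:L\to L_e$ epic, let $L_e\xrightarrow{f'}F\xrightarrow{f''}L'$ be the rm-materialization of $f$; let $F\xleftarrow{p}F'\xrightarrow{q}K'$ be a pullback of $F\xrightarrow{f''}L'\xleftarrow{l'}K'$; let $L_e\xleftarrow{l_e}K_e\xrightarrow{k}F'$ be a pullback of $L_e\xrightarrow{f'}F\xleftarrow{p}F'$; let $j:K\to K_e$ be induced by these pullbacks from $e\circ l:K\to L_e$ and the morphism $K\to F'$ induced by $f'el$ and $t_K$; and let $K_e\xrightarrow{r_e}R_e\leftarrow R$ be a pushout of $K_e\xleftarrow{j}K\xrightarrow{r}R$. Then $\rho_e$ is the PBPO$^+$ rule with $l=l_e$, $r=r_e$, $t_L=f'$, $t_K=k$,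 $l'=p$ (lhs $L_e$, interface $K_e$, rhs $R_e$, types $F$, $F'$). $\mathrm{compact}(\rho)=\{\rho_e\mid t_L=f\circ e,\ e \text{ epic}\}$. *)

theory Defs
  imports Main
begin

section \<open>Categories\<close>

record ('o, 'm) category =
  Obj  :: "'o set"
  Arr  :: "'m set"
  Dom  :: "'m \<Rightarrow> 'o"
  Cod  :: "'m \<Rightarrow> 'o"
  Idt  :: "'o \<Rightarrow> 'm"
  Comp :: "'m \<Rightarrow> 'm \<Rightarrow> 'm"  (infixl "\<cdot>\<index>" 70)

definition hom :: "('o, 'm) category \<Rightarrow> 'o \<Rightarrow> 'o \<Rightarrow> 'm set" where
  "hom C A B = {f \<in> Arr C. Dom C f = A \<and> Cod C f = B}"

locale category =
  fixes C :: "('o, 'm) category" (structure)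
  assumes Dom_in_Obj: "f \<in> Arr C \<Longrightarrow> Dom C f \<in> Obj C"
    and Cod_in_Obj: "f \<in> Arr C \<Longrightarrow> Cod C f \<in> Obj C"
    and Idt_in_hom: "A \<in> Obj C \<Longrightarrow> Idt C A \<in> hom C A A"
    and Comp_in_hom: "\<lbrakk>f \<in> hom C A B; g \<in> hom C B D\<rbrakk> \<Longrightarrow> g \<cdot> f \<in> hom C A D"
    and Comp_Idt: "f \<in> hom C A B \<Longrightarrow> f \<cdot> Idt C A = f"
    and Idt_Comp: "f \<in> hom C A B \<Longrightarrow> Idt C B \<cdot> f = f"
    and Comp_assoc: "\<lbrakk>f \<in> hom C A B; g \<in> hom C B D; h \<in> hom C D E\<rbrakk>
      \<Longrightarrow> (h \<cdot> g) \<cdot> f = h \<cdot> (g \<cdot> f)"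

definition opposite :: "('o, 'm) category \<Rightarrow> ('o, 'm) category" where
  "opposite C = \<lparr>Obj = Obj C, Arr = Arr C, Dom = Cod C, Cod = Dom C, Idt = Idt C,
                 Comp = (\<lambda>g f. f \<cdot>\<^bsub>C\<^esub> g)\<rparr>"

text \<open>An arrow of the slice over \<open>X\<close> from \<open>a\<close> to \<open>b\<close> is a triple \<open>(a, h, b)\<close>, so that it
  determines its domain and codomain.\<close>

definition slice :: "('o, 'm) category \<Rightarrow> 'o \<Rightarrow> ('m, 'm \<times> 'm \<times> 'm) category" where
  "slice C X = \<lparr>
     Obj = {a \<in> Arr C. Cod C a = X},
     Arr = {(a, h, b). a \<in> Arr C \<and> b \<in> Arr C \<and> Cod C a = X \<and> Cod C b = X \<and>
                       h \<in> hom C (Dom C a) (Dom C b) \<and> b \<cdot>\<^bsub>C\<^esub> h = a},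
     Dom = (\<lambda>(a, h, b). a),
     Cod = (\<lambda>(a, h, b). b),
     Idt = (\<lambda>a. (a, Idt C (Dom C a), a)),
     Comp = (\<lambda>(b', k, c) (a, h, b). (a, k \<cdot>\<^bsub>C\<^esub> h, c))\<rparr>"


section \<open>Finite limits and colimits\<close>

definition is_functor ::
  "('j, 'k) category \<Rightarrow> ('o, 'm) category \<Rightarrow> ('j \<Rightarrow> 'o) \<Rightarrow> ('k \<Rightarrow> 'm) \<Rightarrow> bool" where
  "is_functor J C FO FA \<longleftrightarrow>
     (\<forall>i\<in>Obj J. FO i \<in> Obj C \<and> FA (Idt J i) = Idt C (FO i)) \<and>
     (\<forall>u\<in>Arr J. FA u \<in> hom C (FO (Dom J u)) (FO (Cod J u))) \<and>
     (\<forall>u\<in>Arr J. \<forall>v\<in>Arr J. Cod J u = Dom J v \<longrightarrow> FA (v \<cdot>\<^bsub>J\<^esub> u) = FA v \<cdot>\<^bsub>C\<^esub> FA u)"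

definition is_cone ::
  "('j, 'k) category \<Rightarrow> ('o, 'm) category \<Rightarrow> ('j \<Rightarrow> 'o) \<Rightarrow> ('k \<Rightarrow> 'm) \<Rightarrow> 'o \<Rightarrow> ('j \<Rightarrow> 'm) \<Rightarrow> bool"
  where
  "is_cone J C FO FA A \<pi> \<longleftrightarrow>
     A \<in> Obj C \<and> (\<forall>i\<in>Obj J. \<pi> i \<in> hom C A (FO i)) \<and>
     (\<forall>u\<in>Arr J. FA u \<cdot>\<^bsub>C\<^esub> \<pi> (Dom J u) = \<pi> (Cod J u))"

definition is_limit ::
  "('j, 'k) category \<Rightarrow> ('o, 'm) category \<Rightarrow> ('j \<Rightarrow> 'o) \<Rightarrow> ('k \<Rightarrow> 'm) \<Rightarrow> 'o \<Rightarrow> ('j \<Rightarrow> 'm) \<Rightarrow> bool"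
  where
  "is_limit J C FO FA A \<pi> \<longleftrightarrow>
     is_cone J C FO FA A \<pi> \<and>
     (\<forall>B \<sigma>. is_cone J C FO FA B \<sigma> \<longrightarrow>
        (\<exists>!h. h \<in> hom C B A \<and> (\<forall>i\<in>Obj J. \<pi> i \<cdot>\<^bsub>C\<^esub> h = \<sigma> i)))"

text \<open>Every finite category is isomorphic to one whose objects and arrows are natural numbers,
  so it suffices to quantify over those index categories.\<close>

definition has_finite_limits :: "('o, 'm) category \<Rightarrow> bool" where
  "has_finite_limits C \<longleftrightarrow>
     (\<forall>(J :: (nat, nat) category) FO FA.
        category J \<and> finite (Obj J) \<and> finite (Arr J) \<and> is_functor J C FO FA \<longrightarrow>
        (\<exists>A \<pi>. is_limit J C FO FA A \<pi>))"

definition has_finite_colimits :: "('o, 'm) category \<Rightarrow> bool" where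
  "has_finite_colimits C \<longleftrightarrow> has_finite_limits (opposite C)"

definition is_terminal :: "('o, 'm) category \<Rightarrow> 'o \<Rightarrow> bool" where
  "is_terminal C T \<longleftrightarrow> T \<in> Obj C \<and> (\<forall>A\<in>Obj C. \<exists>!h. h \<in> hom C A T)"

definition is_product :: "('o, 'm) category \<Rightarrow> 'o \<Rightarrow> 'o \<Rightarrow> 'o \<Rightarrow> 'm \<Rightarrow> 'm \<Rightarrow> bool" where
  "is_product C A B P p q \<longleftrightarrow>
     p \<in> hom C P A \<and> q \<in> hom C P B \<and>
     (\<forall>X x y. x \<in> hom C X A \<and> y \<in> hom C X B \<longrightarrow>
        (\<exists>!h. h \<in> hom C X P \<and> p \<cdot>\<^bsub>C\<^esub> h = x \<and> q \<cdot>\<^bsub>C\<^esub> h = y))"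

text \<open>The span \<open>(p, q)\<close> is a pullback of the cospan \<open>(f, g)\<close>, with \<open>f p = g q\<close>.\<close>

definition is_pullback :: "('o, 'm) category \<Rightarrow> 'm \<Rightarrow> 'm \<Rightarrow> 'm \<Rightarrow> 'm \<Rightarrow> bool" where
  "is_pullback C p q f g \<longleftrightarrow>
     f \<in> Arr C \<and> g \<in> Arr C \<and> Cod C f = Cod C g \<and>
     p \<in> hom C (Dom C p) (Dom C f) \<and> q \<in> hom C (Dom C p) (Dom C g) \<and>
     f \<cdot>\<^bsub>C\<^esub> p = g \<cdot>\<^bsub>C\<^esub> q \<and>
     (\<forall>X x y. x \<in> hom C X (Dom C f) \<and> y \<in> hom C X (Dom C g) \<and> f \<cdot>\<^bsub>C\<^esub> x = g \<cdot>\<^bsub>C\<^esub> y \<longrightarrow>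
        (\<exists>!h. h \<in> hom C X (Dom C p) \<and> p \<cdot>\<^bsub>C\<^esub> h = x \<and> q \<cdot>\<^bsub>C\<^esub> h = y))"

text \<open>The cospan \<open>(i, j)\<close> is a pushout of the span \<open>(f, g)\<close>, with \<open>i f = j g\<close>.\<close>

definition is_pushout :: "('o, 'm) category \<Rightarrow> 'm \<Rightarrow> 'm \<Rightarrow> 'm \<Rightarrow> 'm \<Rightarrow> bool" where
  "is_pushout C f g i j \<longleftrightarrow>
     f \<in> Arr C \<and> g \<in> Arr C \<and> Dom C f = Dom C g \<and>
     i \<in> hom C (Cod C f) (Cod C i) \<and> j \<in> hom C (Cod C g) (Cod C i) \<and>
     i \<cdot>\<^bsub>C\<^esub> f = j \<cdot>\<^bsub>C\<^esub> g \<and>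
     (\<forall>X x y. x \<in> hom C (Cod C f) X \<and> y \<in> hom C (Cod C g) X \<and> x \<cdot>\<^bsub>C\<^esub> f = y \<cdot>\<^bsub>C\<^esub> g \<longrightarrow>
        (\<exists>!h. h \<in> hom C (Cod C i) X \<and> h \<cdot>\<^bsub>C\<^esub> i = x \<and> h \<cdot>\<^bsub>C\<^esub> j = y))"


section \<open>Quasitopoi\<close>

definition is_epi :: "('o, 'm) category \<Rightarrow> 'm \<Rightarrow> bool" where
  "is_epi C e \<longleftrightarrow>
     e \<in> Arr C \<and>
     (\<forall>X x y. x \<in> hom C (Cod C e) X \<and> y \<in> hom C (Cod C e) X \<and> x \<cdot>\<^bsub>C\<^esub> e = y \<cdot>\<^bsub>C\<^esub> e \<longrightarrow> x = y)"

definition is_equalizer :: "('o, 'm) category \<Rightarrow> 'm \<Rightarrow> 'm \<Rightarrow> 'm \<Rightarrow> bool" where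
  "is_equalizer C m f g \<longleftrightarrow>
     f \<in> Arr C \<and> g \<in> hom C (Dom C f) (Cod C f) \<and> m \<in> hom C (Dom C m) (Dom C f) \<and>
     f \<cdot>\<^bsub>C\<^esub> m = g \<cdot>\<^bsub>C\<^esub> m \<and>
     (\<forall>X x. x \<in> hom C X (Dom C f) \<and> f \<cdot>\<^bsub>C\<^esub> x = g \<cdot>\<^bsub>C\<^esub> x \<longrightarrow>
        (\<exists>!h. h \<in> hom C X (Dom C m) \<and> m \<cdot>\<^bsub>C\<^esub> h = x))"

definition is_regular_mono :: "('o, 'm) category \<Rightarrow> 'm \<Rightarrow> bool" where
  "is_regular_mono C m \<longleftrightarrow> (\<exists>f g. is_equalizer C m f g)"

text \<open>\<open>E\<close> is the exponential \<open>B\<^sup>A\<close>, with evaluation \<open>ev\<close> defined on the product \<open>(P, p, q)\<close> of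
  \<open>E\<close> and \<open>A\<close>. The arrow \<open>k\<close> below is \<open>h \<times> 1\<close>.\<close>

definition is_exponential ::
  "('o, 'm) category \<Rightarrow> 'o \<Rightarrow> 'o \<Rightarrow> 'o \<Rightarrow> 'o \<Rightarrow> 'm \<Rightarrow> 'm \<Rightarrow> 'm \<Rightarrow> bool" where
  "is_exponential C A B E P p q ev \<longleftrightarrow>
     is_product C E A P p q \<and> ev \<in> hom C P B \<and>
     (\<forall>X Q p' q' g. is_product C X A Q p' q' \<and> g \<in> hom C Q B \<longrightarrow>
        (\<exists>!h. h \<in> hom C X E \<and>
           (\<exists>k. k \<in> hom C Q P \<and> p \<cdot>\<^bsub>C\<^esub> k = h \<cdot>\<^bsub>C\<^esub> p' \<and> q \<cdot>\<^bsub>C\<^esub> k = q' \<and> ev \<cdot>\<^bsub>C\<^esub> k = g)))"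

definition cartesian_closed :: "('o, 'm) category \<Rightarrow> bool" where
  "cartesian_closed C \<longleftrightarrow>
     (\<exists>T. is_terminal C T) \<and>
     (\<forall>A\<in>Obj C. \<forall>B\<in>Obj C. \<exists>P p q. is_product C A B P p q) \<and>
     (\<forall>A\<in>Obj C. \<forall>B\<in>Obj C. \<exists>E P p q ev. is_exponential C A B E P p q ev)"

definition locally_cartesian_closed :: "('o, 'm) category \<Rightarrow> bool" where
  "locally_cartesian_closed C \<longleftrightarrow> (\<forall>X\<in>Obj C. cartesian_closed (slice C X))"

definition is_regular_subobject_classifier :: "('o, 'm) category \<Rightarrow> 'm \<Rightarrow> bool" where
  "is_regular_subobject_classifier C tr \<longleftrightarrow>
     tr \<in> Arr C \<and> is_terminal C (Dom C tr) \<and>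
     (\<forall>m. is_regular_mono C m \<longrightarrow>
        (\<exists>!\<chi>. \<chi> \<in> hom C (Cod C m) (Cod C tr) \<and>
           (\<exists>t. t \<in> hom C (Dom C m) (Dom C tr) \<and> is_pullback C m t \<chi> tr)))"

locale quasitopos = category +
  assumes finite_limits: "has_finite_limits C"
    and finite_colimits: "has_finite_colimits C"
    and loc_cart_closed: "locally_cartesian_closed C"
    and classifier: "\<exists>tr. is_regular_subobject_classifier C tr"


section \<open>PBPO and PBPO+ rewriting\<close>

text \<open>The objects of a rule are the domains and codomains of its arrows: \<open>L\<close>, \<open>K\<close>, \<open>R\<close>, \<open>L'\<close>,
  \<open>K'\<close>, \<open>R'\<close> are \<open>Cod lmor\<close>, \<open>Dom lmor\<close>, \<open>Cod rmor\<close>, \<open>Cod lmor'\<close>, \<open>Dom lmor'\<close>, \<open>Cod rmor'\<close>.\<close>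

record 'm pbpo_plus_rule =
  lmor  :: 'm  \<comment> \<open>\<open>l : K \<rightarrow> L\<close>\<close>
  rmor  :: 'm  \<comment> \<open>\<open>r : K \<rightarrow> R\<close>\<close>
  typL  :: 'm  \<comment> \<open>\<open>t\<^sub>L : L \<rightarrow> L'\<close>\<close>
  typK  :: 'm  \<comment> \<open>\<open>t\<^sub>K : K \<rightarrow> K'\<close>\<close>
  lmor' :: 'm  \<comment> \<open>\<open>l' : K' \<rightarrow> L'\<close>\<close>

record 'm pbpo_rule = "'m pbpo_plus_rule" +
  rmor' :: 'm  \<comment> \<open>\<open>r' : K' \<rightarrow> R'\<close>\<close>
  typR  :: 'm  \<comment> \<open>\<open>t\<^sub>R : R \<rightarrow> R'\<close>\<close>

definition is_pbpo_rule :: "('o, 'm) category \<Rightarrow> 'm pbpo_rule \<Rightarrow> bool" where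
  "is_pbpo_rule C \<rho> \<longleftrightarrow>
     (\<exists>L K R L' K' R'.
        lmor \<rho> \<in> hom C K L \<and> rmor \<rho> \<in> hom C K R \<and>
        lmor' \<rho> \<in> hom C K' L' \<and> rmor' \<rho> \<in> hom C K' R' \<and>
        typL \<rho> \<in> hom C L L' \<and> typK \<rho> \<in> hom C K K' \<and> typR \<rho> \<in> hom C R R') \<and>
     typL \<rho> \<cdot>\<^bsub>C\<^esub> lmor \<rho> = lmor' \<rho> \<cdot>\<^bsub>C\<^esub> typK \<rho> \<and>
     typR \<rho> \<cdot>\<^bsub>C\<^esub> rmor \<rho> = rmor' \<rho> \<cdot>\<^bsub>C\<^esub> typK \<rho>"

definition is_canonical :: "('o, 'm) category \<Rightarrow> 'm pbpo_rule \<Rightarrow> bool" where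
  "is_canonical C \<rho> \<longleftrightarrow>
     is_pullback C (lmor \<rho>) (typK \<rho>) (typL \<rho>) (lmor' \<rho>) \<and>
     is_pushout C (rmor \<rho>) (typK \<rho>) (typR \<rho>) (rmor' \<rho>)"

definition is_pbpo_plus_rule :: "('o, 'm) category \<Rightarrow> 'm pbpo_plus_rule \<Rightarrow> bool" where
  "is_pbpo_plus_rule C \<tau> \<longleftrightarrow>
     rmor \<tau> \<in> Arr C \<and> Dom C (rmor \<tau>) = Dom C (lmor \<tau>) \<and>
     is_pullback C (lmor \<tau>) (typK \<tau>) (typL \<tau>) (lmor' \<tau>)"

definition pbpo_step :: "('o, 'm) category \<Rightarrow> 'm pbpo_rule \<Rightarrow> ('o \<times> 'o) set" where
  "pbpo_step C \<rho> = {(GL, GR).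
     \<exists>m \<alpha> GK gL u' u gR w.
       m \<in> hom C (Cod C (lmor \<rho>)) GL \<and>
       \<alpha> \<in> hom C GL (Cod C (lmor' \<rho>)) \<and>
       typL \<rho> = \<alpha> \<cdot>\<^bsub>C\<^esub> m \<and>
       gL \<in> hom C GK GL \<and> u' \<in> hom C GK (Dom C (lmor' \<rho>)) \<and>
       is_pullback C gL u' \<alpha> (lmor' \<rho>) \<and>
       u \<in> hom C (Dom C (lmor \<rho>)) GK \<and>
       gL \<cdot>\<^bsub>C\<^esub> u = m \<cdot>\<^bsub>C\<^esub> lmor \<rho> \<and> u' \<cdot>\<^bsub>C\<^esub> u = typK \<rho> \<and>
       gR \<in> hom C GK GR \<and> w \<in> hom C (Cod C (rmor \<rho>)) GR \<and>
       is_pushout C u (rmor \<rho>) gR w}"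

definition pbpo_plus_step :: "('o, 'm) category \<Rightarrow> 'm pbpo_plus_rule \<Rightarrow> ('o \<times> 'o) set" where
  "pbpo_plus_step C \<tau> = {(GL, GR).
     \<exists>m \<alpha> GK gL u' u gR w.
       m \<in> hom C (Cod C (lmor \<tau>)) GL \<and>
       \<alpha> \<in> hom C GL (Cod C (lmor' \<tau>)) \<and>
       typL \<tau> = \<alpha> \<cdot>\<^bsub>C\<^esub> m \<and>
       is_pullback C (Idt C (Cod C (lmor \<tau>))) m (typL \<tau>) \<alpha> \<and>
       gL \<in> hom C GK GL \<and> u' \<in> hom C GK (Dom C (lmor' \<tau>)) \<and>
       is_pullback C gL u' \<alpha> (lmor' \<tau>) \<and>
       u \<in> hom C (Dom C (lmor \<tau>)) GK \<and> u' \<cdot>\<^bsub>C\<^esub> u = typK \<tau> \<and>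
       (\<forall>v. v \<in> hom C (Dom C (lmor \<tau>)) GK \<and> u' \<cdot>\<^bsub>C\<^esub> v = typK \<tau> \<longrightarrow> v = u) \<and>
       gR \<in> hom C GK GR \<and> w \<in> hom C (Cod C (rmor \<tau>)) GR \<and>
       is_pushout C u (rmor \<tau>) gR w}"


section \<open>Materialization and compaction\<close>

definition is_rm_materialization :: "('o, 'm) category \<Rightarrow> 'm \<Rightarrow> 'm \<Rightarrow> 'm \<Rightarrow> bool" where
  "is_rm_materialization C f f' f'' \<longleftrightarrow>
     f \<in> Arr C \<and>
     f' \<in> hom C (Dom C f) (Cod C f') \<and> f'' \<in> hom C (Cod C f') (Cod C f) \<and>
     f'' \<cdot>\<^bsub>C\<^esub> f' = f \<and> is_regular_mono C f' \<and>
     (\<forall>X m \<alpha>.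
        m \<in> hom C (Dom C f) X \<and> \<alpha> \<in> hom C X (Cod C f) \<and> \<alpha> \<cdot>\<^bsub>C\<^esub> m = f \<and> is_regular_mono C m \<longrightarrow>
        (\<exists>!\<beta>. \<beta> \<in> hom C X (Cod C f') \<and> f'' \<cdot>\<^bsub>C\<^esub> \<beta> = \<alpha> \<and>
           is_pullback C m (Idt C (Dom C f)) \<beta> f'))"

text \<open>Materializations, pullbacks and pushouts are unique only up to isomorphism, so the compacted
  rule \<open>\<rho>\<^sub>e\<close> is a relation between \<open>e\<close> (with \<open>t\<^sub>L = f e\<close>) and \<open>\<tau>\<close>: \<open>\<tau>\<close> is \<open>\<rho>\<^sub>e\<close> for some choice of
  these universal constructions.\<close>

definition is_compacted_rule ::
  "('o, 'm) category \<Rightarrow> 'm pbpo_rule \<Rightarrow> 'm \<Rightarrow> 'm \<Rightarrow> 'm pbpo_plus_rule \<Rightarrow> bool" where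
  "is_compacted_rule C \<rho> e f \<tau> \<longleftrightarrow>
     (\<exists>f' f'' p q le k v j re iR.
        is_rm_materialization C f f' f'' \<and>
        is_pullback C p q f'' (lmor' \<rho>) \<and>
        is_pullback C le k f' p \<and>
        v \<in> hom C (Dom C (lmor \<rho>)) (Dom C p) \<and>
        p \<cdot>\<^bsub>C\<^esub> v = f' \<cdot>\<^bsub>C\<^esub> (e \<cdot>\<^bsub>C\<^esub> lmor \<rho>) \<and> q \<cdot>\<^bsub>C\<^esub> v = typK \<rho> \<and>
        j \<in> hom C (Dom C (lmor \<rho>)) (Dom C le) \<and>
        le \<cdot>\<^bsub>C\<^esub> j = e \<cdot>\<^bsub>C\<^esub> lmor \<rho> \<and> k \<cdot>\<^bsub>C\<^esub> j = v \<and>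
        is_pushout C j (rmor \<rho>) re iR \<and>
        \<tau> = \<lparr>lmor = le, rmor = re, typL = f', typK = k, lmor' = p\<rparr>)"

definition compact :: "('o, 'm) category \<Rightarrow> 'm pbpo_rule \<Rightarrow> 'm pbpo_plus_rule set" where
  "compact C \<rho> = {\<tau>. \<exists>Le e f.
     e \<in> hom C (Cod C (lmor \<rho>)) Le \<and> f \<in> hom C Le (Cod C (lmor' \<rho>)) \<and>
     is_epi C e \<and> typL \<rho> = f \<cdot>\<^bsub>C\<^esub> e \<and> is_compacted_rule C \<rho> e f \<tau>}"

lemma category_opposite: "category C \<Longrightarrow> category (opposite C)"
  by (auto simp: category_def opposite_def hom_def)

lemma category_slice:
  assumes "category C" shows "category (slice C X)"
proof -
  interpret category C by fact
  show ?thesis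
  proof
    fix f g h A B D E
    let ?S = "slice C X"
    show "f \<in> Arr ?S \<Longrightarrow> Dom ?S f \<in> Obj ?S" "f \<in> Arr ?S \<Longrightarrow> Cod ?S f \<in> Obj ?S"
      by (auto simp: slice_def)
    show "A \<in> Obj ?S \<Longrightarrow> Idt ?S A \<in> hom ?S A A"
      using Idt_in_hom[OF Dom_in_Obj] Comp_Idt[of A "Dom C A" "Cod C A"]
      by (auto simp: slice_def hom_def)
    show "\<lbrakk>f \<in> hom ?S A B; g \<in> hom ?S B D\<rbrakk> \<Longrightarrow> g \<cdot>\<^bsub>?S\<^esub> f \<in> hom ?S A D"
    proof -
      assume "f \<in> hom ?S A B" "g \<in> hom ?S B D"
      then obtain h k where f: "f = (A, h, B)" and g: "g = (B, k, D)"
        and ABD: "A \<in> Arr C" "B \<in> Arr C" "D \<in> Arr C" "Cod C A = X" "Cod C D = X"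
        and h: "h \<in> hom C (Dom C A) (Dom C B)" "B \<cdot>\<^bsub>C\<^esub> h = A"
        and k: "k \<in> hom C (Dom C B) (Dom C D)" "D \<cdot>\<^bsub>C\<^esub> k = B"
        by (auto simp: slice_def hom_def)
      have "D \<cdot>\<^bsub>C\<^esub> (k \<cdot>\<^bsub>C\<^esub> h) = A"
        using Comp_assoc[OF h(1) k(1), of D "Cod C D"] h(2) k(2) ABD by (simp add: hom_def)
      then show ?thesis
        using ABD Comp_in_hom[OF h(1) k(1)] by (simp add: f g slice_def hom_def)
    qed
    show "f \<in> hom ?S A B \<Longrightarrow> f \<cdot>\<^bsub>?S\<^esub> Idt ?S A = f" "f \<in> hom ?S A B \<Longrightarrow> Idt ?S B \<cdot>\<^bsub>?S\<^esub> f = f"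
      by (auto simp: slice_def hom_def intro!: Comp_Idt Idt_Comp)
    show "\<lbrakk>f \<in> hom ?S A B; g \<in> hom ?S B D; h \<in> hom ?S D E\<rbrakk>
        \<Longrightarrow> (h \<cdot>\<^bsub>?S\<^esub> g) \<cdot>\<^bsub>?S\<^esub> f = h \<cdot>\<^bsub>?S\<^esub> (g \<cdot>\<^bsub>?S\<^esub> f)"
      by (auto simp: slice_def hom_def intro!: Comp_assoc)
  qed
qed

lemma compact_is_pbpo_plus_rule:
  "\<tau> \<in> compact C \<rho> \<Longrightarrow> is_pbpo_plus_rule C \<tau>"
  by (auto simp: compact_def is_compacted_rule_def is_pbpo_plus_rule_def is_pushout_def hom_def)

end

theory Submission
  imports Defs
begin

text \<open>
  A PBPO match \<open>m\<close> with adherence \<open>\<alpha>\<close> factors as \<open>m = n e\<close> with \<open>e\<close> epic and \<open>n\<close> a regular mono, so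
  \<open>t\<^sub>L = f e\<close> for \<open>f = \<alpha> n\<close>. The materialization \<open>f = f'' f'\<close> turns \<open>\<alpha>\<close> into a unique \<open>\<beta>\<close> over \<open>f''\<close>, for
  which \<open>n\<close> is a strong match of \<open>\<rho>\<^sub>e\<close>. Conversely, a strong match \<open>n\<close> of \<open>\<rho>\<^sub>e\<close> with adherence \<open>\<beta>\<close> yields
  the match \<open>n e\<close> with adherence \<open>f'' \<beta>\<close>. In both cases pasting and cancelling pullbacks shows that the two
  steps have the same \<open>G\<^sub>K\<close>, and pasting and cancelling pushouts that they have the same \<open>G\<^sub>R\<close>.

  Materializations are instances of classifiers of regular partial maps in slices, which also
  show that regular monos compose; hence the equalizer of the cokernel pair of \<open>m\<close> gives the
  factorization of \<open>m\<close>.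
\<close>

section \<open>Arrows, pullbacks and pushouts\<close>

lemma hom_iff: "f \<in> hom C A B \<longleftrightarrow> f \<in> Arr C \<and> Dom C f = A \<and> Cod C f = B"
  by (simp add: hom_def)

context category
begin

lemma comp_arr [simp]:
  assumes "f \<in> Arr C" "g \<in> Arr C" "Cod C f = Dom C g"
  shows "g \<cdot> f \<in> Arr C" "Dom C (g \<cdot> f) = Dom C f" "Cod C (g \<cdot> f) = Cod C g"
  using Comp_in_hom[of f "Dom C f" "Dom C g" g "Cod C g"] assms by (auto simp: hom_def)

lemma comp_assoc [simp]:
  assumes "f \<in> Arr C" "g \<in> Arr C" "h \<in> Arr C" "Cod C f = Dom C g" "Cod C g = Dom C h"
  shows "(h \<cdot> g) \<cdot> f = h \<cdot> (g \<cdot> f)"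
  using Comp_assoc[of f "Dom C f" "Dom C g" g "Dom C h" h "Cod C h"] assms by (simp add: hom_def)

lemma obj_arr [simp]: "f \<in> Arr C \<Longrightarrow> Dom C f \<in> Obj C" "f \<in> Arr C \<Longrightarrow> Cod C f \<in> Obj C"
  by (fact Dom_in_Obj, fact Cod_in_Obj)

lemma idt_arr [simp]:
  assumes "A \<in> Obj C"
  shows "Idt C A \<in> Arr C" "Dom C (Idt C A) = A" "Cod C (Idt C A) = A"
  using Idt_in_hom[OF assms] by (auto simp: hom_def)

lemma idt_comp [simp]:
  "f \<in> Arr C \<Longrightarrow> Cod C f = A \<Longrightarrow> Idt C A \<cdot> f = f"
  "f \<in> Arr C \<Longrightarrow> Dom C f = A \<Longrightarrow> f \<cdot> Idt C A = f"
  by (auto simp: hom_def intro: Idt_Comp Comp_Idt)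

text \<open>The simplifier associates composites to the right, where an equation for
  \<open>x \<cdot> y\<close> no longer matches. This form applies such an equation inside the longer
  composite \<open>x \<cdot> (y \<cdot> z)\<close>.\<close>

lemma comp_extend:
  assumes "x \<cdot> y = w" "x \<in> Arr C" "y \<in> Arr C" "z \<in> Arr C" "Cod C z = Dom C y" "Cod C y = Dom C x"
  shows "x \<cdot> (y \<cdot> z) = w \<cdot> z"
  using assms comp_assoc[of z y x] by simp

end

section \<open>Pullbacks: mediating arrows, joint monicity, pasting and cancellation\<close>

lemma pullback_arr:
  assumes "is_pullback C p q f g"
  shows "f \<in> Arr C" "g \<in> Arr C" "p \<in> Arr C" "q \<in> Arr C" "Cod C g = Cod C f"
    "Dom C q = Dom C p" "Cod C p = Dom C f" "Cod C q = Dom C g" "f \<cdot>\<^bsub>C\<^esub> p = g \<cdot>\<^bsub>C\<^esub> q"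
  using assms by (auto simp: is_pullback_def hom_def)

lemma pullback_lift:
  assumes "is_pullback C p q f g" "x \<in> Arr C" "y \<in> Arr C" "Dom C x = Dom C y"
    "Cod C x = Dom C f" "Cod C y = Dom C g" "f \<cdot>\<^bsub>C\<^esub> x = g \<cdot>\<^bsub>C\<^esub> y"
  obtains h where "h \<in> Arr C" "Dom C h = Dom C x" "Cod C h = Dom C p"
    "p \<cdot>\<^bsub>C\<^esub> h = x" "q \<cdot>\<^bsub>C\<^esub> h = y"
proof -
  have "x \<in> hom C (Dom C x) (Dom C f)" "y \<in> hom C (Dom C x) (Dom C g)"
    using assms(2-6) by (auto simp: hom_iff)
  then have "\<exists>!h. h \<in> hom C (Dom C x) (Dom C p) \<and> p \<cdot>\<^bsub>C\<^esub> h = x \<and> q \<cdot>\<^bsub>C\<^esub> h = y"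
    using assms(1,7) unfolding is_pullback_def by blast
  then show ?thesis using that by (auto simp: hom_iff)
qed

lemma (in category) pullback_eqI:
  assumes "is_pullback C p q f g" "h \<in> Arr C" "h' \<in> Arr C" "Dom C h = Dom C h'"
    "Cod C h = Dom C p" "Cod C h' = Dom C p" "p \<cdot> h = p \<cdot> h'" "q \<cdot> h = q \<cdot> h'"
  shows "h = h'"
proof -
  note pb = pullback_arr[OF assms(1)]
  have "f \<cdot> (p \<cdot> h) = g \<cdot> (q \<cdot> h)"
    using pb assms(2-) comp_assoc[of h p f] comp_assoc[of h q g] by simp
  moreover have "p \<cdot> h \<in> hom C (Dom C h) (Dom C f)" "q \<cdot> h \<in> hom C (Dom C h) (Dom C g)"
    using pb assms(2-) by (auto simp: hom_iff)
  ultimately have "\<exists>!k. k \<in> hom C (Dom C h) (Dom C p) \<and> p \<cdot> k = p \<cdot> h \<and> q \<cdot> k = q \<cdot> h"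
    using assms(1) unfolding is_pullback_def by blast
  then show ?thesis using assms(2-) unfolding hom_iff by metis
qed

text \<open>Uniqueness is asked for as joint monicity of \<open>p\<close> and \<open>q\<close>,
  which can be checked by cancellation without reference to a given cone.\<close>

lemma pullbackI:
  assumes "f \<in> Arr C" "g \<in> Arr C" "p \<in> Arr C" "q \<in> Arr C" "Cod C f = Cod C g"
    "Dom C p = Dom C q" "Cod C p = Dom C f" "Cod C q = Dom C g" "f \<cdot>\<^bsub>C\<^esub> p = g \<cdot>\<^bsub>C\<^esub> q"
    and "\<And>x y. \<lbrakk>x \<in> Arr C; y \<in> Arr C; Dom C x = Dom C y; Cod C x = Dom C f; Cod C y = Dom C g;
        f \<cdot>\<^bsub>C\<^esub> x = g \<cdot>\<^bsub>C\<^esub> y\<rbrakk> \<Longrightarrow>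
      \<exists>h. h \<in> Arr C \<and> Dom C h = Dom C x \<and> Cod C h = Dom C p \<and> p \<cdot>\<^bsub>C\<^esub> h = x \<and> q \<cdot>\<^bsub>C\<^esub> h = y"
    and "\<And>h h'. \<lbrakk>h \<in> Arr C; h' \<in> Arr C; Dom C h = Dom C h'; Cod C h = Dom C p; Cod C h' = Dom C p;
        p \<cdot>\<^bsub>C\<^esub> h = p \<cdot>\<^bsub>C\<^esub> h'; q \<cdot>\<^bsub>C\<^esub> h = q \<cdot>\<^bsub>C\<^esub> h'\<rbrakk> \<Longrightarrow> h = h'"
  shows "is_pullback C p q f g"
  unfolding is_pullback_def hom_iff
proof (intro conjI allI impI)
  fix X x y
  assume xy: "(x \<in> Arr C \<and> Dom C x = X \<and> Cod C x = Dom C f) \<and>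
    (y \<in> Arr C \<and> Dom C y = X \<and> Cod C y = Dom C g) \<and> f \<cdot>\<^bsub>C\<^esub> x = g \<cdot>\<^bsub>C\<^esub> y"
  then obtain h where h: "h \<in> Arr C \<and> Dom C h = X \<and> Cod C h = Dom C p \<and> p \<cdot>\<^bsub>C\<^esub> h = x \<and> q \<cdot>\<^bsub>C\<^esub> h = y"
    using assms(10)[of x y] by metis
  show "\<exists>!h. (h \<in> Arr C \<and> Dom C h = X \<and> Cod C h = Dom C p) \<and> p \<cdot>\<^bsub>C\<^esub> h = x \<and> q \<cdot>\<^bsub>C\<^esub> h = y"
  proof (rule ex1I)
    show "(h \<in> Arr C \<and> Dom C h = X \<and> Cod C h = Dom C p) \<and> p \<cdot>\<^bsub>C\<^esub> h = x \<and> q \<cdot>\<^bsub>C\<^esub> h = y"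
      using h by simp
  next
    fix k
    assume "(k \<in> Arr C \<and> Dom C k = X \<and> Cod C k = Dom C p) \<and> p \<cdot>\<^bsub>C\<^esub> k = x \<and> q \<cdot>\<^bsub>C\<^esub> k = y"
    with h show "k = h" by - (rule assms(11), simp_all)
  qed
qed (simp_all add: assms(1-9))

lemma pullback_sym:
  assumes "is_pullback C p q f g" shows "is_pullback C q p g f"
proof -
  have "\<exists>!h. h \<in> hom C X (Dom C p) \<and> q \<cdot>\<^bsub>C\<^esub> h = x \<and> p \<cdot>\<^bsub>C\<^esub> h = y"
    if "x \<in> hom C X (Dom C g)" "y \<in> hom C X (Dom C f)" "g \<cdot>\<^bsub>C\<^esub> x = f \<cdot>\<^bsub>C\<^esub> y" for X x y
  proof -
    have "\<exists>!h. h \<in> hom C X (Dom C p) \<and> p \<cdot>\<^bsub>C\<^esub> h = y \<and> q \<cdot>\<^bsub>C\<^esub> h = x"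
      using assms that by (auto simp: is_pullback_def)
    then show ?thesis by (simp only: conj_commute)
  qed
  then show ?thesis
    using pullback_arr[OF assms] unfolding is_pullback_def by (auto simp: hom_iff)
qed

text \<open>The two squares are glued along \<open>b\<close>: a cone over the outer square is lifted
  first through \<open>(a, b)\<close> and then through \<open>(c, d)\<close>.\<close>

lemma (in category) pullback_paste:
  assumes "is_pullback C a b f g" "is_pullback C c d b h"
  shows "is_pullback C (a \<cdot> c) d f (g \<cdot> h)"
proof -
  note t = pullback_arr[OF assms(1)] pullback_arr[OF assms(2)]
  show ?thesis
  proof (rule pullbackI)
    show "f \<cdot> (a \<cdot> c) = g \<cdot> h \<cdot> d"
      using t comp_assoc[of c a f] comp_assoc[of c b g] by simp
  next
    fix x y
    assume xy: "x \<in> Arr C" "y \<in> Arr C" "Dom C x = Dom C y" "Cod C x = Dom C f"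
      "Cod C y = Dom C (g \<cdot> h)" "f \<cdot> x = g \<cdot> h \<cdot> y"
    obtain k where k: "k \<in> Arr C" "Dom C k = Dom C x" "Cod C k = Dom C a" "a \<cdot> k = x" "b \<cdot> k = h \<cdot> y"
      by (rule pullback_lift[OF assms(1), of x "h \<cdot> y"]) (use xy t in auto)
    obtain k' where "k' \<in> Arr C" "Dom C k' = Dom C k" "Cod C k' = Dom C c" "c \<cdot> k' = k" "d \<cdot> k' = y"
      by (rule pullback_lift[OF assms(2), of k y]) (use xy t k in auto)
    then show "\<exists>h. h \<in> Arr C \<and> Dom C h = Dom C x \<and> Cod C h = Dom C (a \<cdot> c) \<and> a \<cdot> c \<cdot> h = x \<and> d \<cdot> h = y"
      using k t by (intro exI[of _ k']) auto
  next
    fix k k'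
    assume k: "k \<in> Arr C" "k' \<in> Arr C" "Dom C k = Dom C k'" "Cod C k = Dom C (a \<cdot> c)"
      "Cod C k' = Dom C (a \<cdot> c)" "a \<cdot> c \<cdot> k = a \<cdot> c \<cdot> k'" "d \<cdot> k = d \<cdot> k'"
    have bc: "b \<cdot> (c \<cdot> k) = b \<cdot> (c \<cdot> k')"
      using t k comp_assoc[of k c b] comp_assoc[of k' c b] by simp
    have ck: "c \<cdot> k = c \<cdot> k'"
      by (rule pullback_eqI[OF assms(1)]) (use k t bc in auto)
    show "k = k'"
      by (rule pullback_eqI[OF assms(2)]) (use k t ck in auto)
  qed (use t in auto)
qed

text \<open>A cone \<open>(x, y)\<close> over the inner square gives the cone
  \<open>(a \<cdot> x, y)\<close> over the outer one. Its mediating arrow \<open>k\<close> satisfies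
  \<open>c \<cdot> k = x\<close> because \<open>a\<close> and \<open>b\<close> are jointly
  monic.\<close>

lemma (in category) pullback_cancel:
  assumes "is_pullback C a b f g" "is_pullback C (a \<cdot> c) d f (g \<cdot> h)" "b \<cdot> c = h \<cdot> d"
    "c \<in> Arr C" "Cod C c = Dom C a" "h \<in> Arr C" "Cod C h = Dom C g"
  shows "is_pullback C c d b h"
proof -
  note t = pullback_arr[OF assms(1)] pullback_arr[OF assms(2)] assms(3-)
  show ?thesis
  proof (rule pullbackI)
    fix x y
    assume xy: "x \<in> Arr C" "y \<in> Arr C" "Dom C x = Dom C y" "Cod C x = Dom C b"
      "Cod C y = Dom C h" "b \<cdot> x = h \<cdot> y"
    have eq: "f \<cdot> (a \<cdot> x) = g \<cdot> h \<cdot> y"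
      using t xy comp_extend[of f a "g \<cdot> b" x] by simp
    obtain k where k: "k \<in> Arr C" "Dom C k = Dom C x" "Cod C k = Dom C c" "a \<cdot> c \<cdot> k = a \<cdot> x" "d \<cdot> k = y"
      by (rule pullback_lift[OF assms(2), of "a \<cdot> x" y]) (use t xy eq in auto)
    have "b \<cdot> (c \<cdot> k) = b \<cdot> x"
      using comp_extend[OF assms(3), of k] xy k t by simp
    then have "c \<cdot> k = x"
      by - (rule pullback_eqI[OF assms(1)], use xy k t in auto)
    then show "\<exists>h. h \<in> Arr C \<and> Dom C h = Dom C x \<and> Cod C h = Dom C c \<and> c \<cdot> h = x \<and> d \<cdot> h = y"
      using k by auto
  next
    fix k k'
    assume k: "k \<in> Arr C" "k' \<in> Arr C" "Dom C k = Dom C k'" "Cod C k = Dom C c"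
      "Cod C k' = Dom C c" "c \<cdot> k = c \<cdot> k'" "d \<cdot> k = d \<cdot> k'"
    show "k = k'"
      by (rule pullback_eqI[OF assms(2)]) (use k t in auto)
  qed (use t in auto)
qed

section \<open>Pushouts as pullbacks in the opposite category\<close>

lemma pushout_iff_pullback_opposite:
  "is_pushout C f g i j \<longleftrightarrow> is_pullback (opposite C) i j f g"
  unfolding is_pushout_def is_pullback_def by (simp add: opposite_def hom_def conj_ac)

lemma opposite_simps [simp]:
  "Arr (opposite C) = Arr C" "Dom (opposite C) = Cod C" "Cod (opposite C) = Dom C"
  "g \<cdot>\<^bsub>opposite C\<^esub> f = f \<cdot>\<^bsub>C\<^esub> g"
  by (auto simp: opposite_def)

lemmas pushout_arr = pullback_arr[of "opposite C" for C, folded pushout_iff_pullback_opposite, simplified]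
lemmas pushout_lift = pullback_lift[of "opposite C" for C, folded pushout_iff_pullback_opposite, simplified]

text \<open>Here the common side is \<open>i\<close>, the first leg of the first pushout, whereas
  pullbacks are pasted along the second leg. Hence the squares are flipped before and after
  dualizing.\<close>

lemma (in category) pushout_paste:
  assumes "is_pushout C f g i j" "is_pushout C h i k n"
  shows "is_pushout C (h \<cdot> f) g k (n \<cdot> j)"
proof -
  interpret op: category "opposite C" by (rule category_opposite) unfold_locales
  show ?thesis
    using op.pullback_paste[of j i g f n k h] assms[unfolded pushout_iff_pullback_opposite, THEN pullback_sym]
    unfolding pushout_iff_pullback_opposite by (auto intro: pullback_sym)
qed

lemma (in category) pushout_cancel:
  assumes "is_pushout C f g i j" "is_pushout C (h \<cdot> f) g k (n \<cdot> j)" "n \<cdot> i = k \<cdot> h"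
    "n \<in> Arr C" "Dom C n = Cod C j" "h \<in> Arr C" "Dom C h = Cod C f"
  shows "is_pushout C h i k n"
proof -
  interpret op: category "opposite C" by (rule category_opposite) unfold_locales
  show ?thesis
    using op.pullback_cancel[of j i g f n k h] assms(3-)
      assms(1,2)[unfolded pushout_iff_pullback_opposite, THEN pullback_sym]
    unfolding pushout_iff_pullback_opposite by (auto intro: pullback_sym)
qed

section \<open>Pullbacks from finite limits\<close>

text \<open>The arrows \<open>0, 1, 2\<close> are the identities; \<open>3 : 0 \<rightarrow> 2\<close> and \<open>4 : 1 \<rightarrow> 2\<close>.\<close>

definition cospan_shape :: "(nat, nat) category" where
  "cospan_shape = \<lparr>Obj = {0, 1, 2}, Arr = {0, 1, 2, 3, 4},
     Dom = (\<lambda>u. if u = 3 then 0 else if u = 4 then 1 else u),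
     Cod = (\<lambda>u. if u < 3 then u else 2), Idt = id,
     Comp = (\<lambda>v u. if u < 3 then v else u)\<rparr>"

lemma category_cospan_shape: "category cospan_shape"
  by (auto simp: category_def cospan_shape_def hom_def split: if_splits)

text \<open>Stated for any category with finite limits, so that its instance at
  \<open>opposite C\<close> yields pushouts.\<close>

lemma pullback_exists:
  fixes C (structure)
  assumes "category C" "has_finite_limits C"
    and "f \<in> Arr C" "g \<in> Arr C" "Cod C f = Cod C g"
  obtains p q where "is_pullback C p q f g"
proof -
  interpret category C by fact
  define FO where "FO = (\<lambda>i::nat. if i = 0 then Dom C f else if i = 1 then Dom C g else Cod C f)"
  define FA where "FA = (\<lambda>u::nat. if u = 3 then f else if u = 4 then g else Idt C (FO u))"
  \<comment> \<open>A cone has a third leg, to the common codomain. It is determined by the other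
    two, so cones amount to commuting squares.\<close>
  have cone: "is_cone cospan_shape C FO FA B \<sigma> \<longleftrightarrow> B \<in> Obj C \<and>
      \<sigma> 0 \<in> hom C B (Dom C f) \<and> \<sigma> 1 \<in> hom C B (Dom C g) \<and> \<sigma> 2 = f \<cdot> \<sigma> 0 \<and> f \<cdot> \<sigma> 0 = g \<cdot> \<sigma> 1" for B \<sigma>
    using assms(3-) unfolding is_cone_def cospan_shape_def FO_def FA_def hom_def
    by (simp add: all_conj_distrib) (safe; simp)
  have "is_functor cospan_shape C FO FA"
    using assms(3-) by (auto simp: is_functor_def cospan_shape_def FO_def FA_def hom_def)
  moreover have "finite (Obj cospan_shape)" "finite (Arr cospan_shape)"
    by (auto simp: cospan_shape_def)
  ultimately obtain A \<pi> where lim: "is_limit cospan_shape C FO FA A \<pi>"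
    using assms(2) category_cospan_shape unfolding has_finite_limits_def by blast
  then have \<pi>: "A \<in> Obj C" "\<pi> 0 \<in> hom C A (Dom C f)" "\<pi> 1 \<in> hom C A (Dom C g)"
      "\<pi> 2 = f \<cdot> \<pi> 0" "f \<cdot> \<pi> 0 = g \<cdot> \<pi> 1"
    by (auto simp: is_limit_def cone)
  have "is_pullback C (\<pi> 0) (\<pi> 1) f g"
    unfolding is_pullback_def
  proof (intro conjI allI impI)
    fix X x y
    assume xy: "x \<in> hom C X (Dom C f) \<and> y \<in> hom C X (Dom C g) \<and> f \<cdot> x = g \<cdot> y"
    define \<sigma> where "\<sigma> = (\<lambda>i::nat. if i = 0 then x else if i = 1 then y else f \<cdot> x)"
    have "is_cone cospan_shape C FO FA X \<sigma>"
      using xy by (auto simp: cone \<sigma>_def hom_def)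
    then have "\<exists>!h. h \<in> hom C X A \<and> (\<forall>i\<in>Obj cospan_shape. \<pi> i \<cdot> h = \<sigma> i)"
      using lim by (auto simp: is_limit_def)
    moreover have "(\<forall>i\<in>Obj cospan_shape. \<pi> i \<cdot> h = \<sigma> i) \<longleftrightarrow> \<pi> 0 \<cdot> h = x \<and> \<pi> 1 \<cdot> h = y"
      if "h \<in> hom C X A" for h
      using that \<pi> assms(3-) comp_assoc[of h "\<pi> 0" f]
      by (auto simp: cospan_shape_def \<sigma>_def hom_def simp del: comp_assoc)
    moreover have "Dom C (\<pi> 0) = A" using \<pi> by (simp add: hom_def)
    ultimately show "\<exists>!h. h \<in> hom C X (Dom C (\<pi> 0)) \<and> \<pi> 0 \<cdot> h = x \<and> \<pi> 1 \<cdot> h = y"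
      by (simp cong: conj_cong)
  qed (use \<pi> assms(3-) in \<open>auto simp: hom_def\<close>)
  then show ?thesis by (rule that)
qed

section \<open>Regular monomorphisms\<close>

context category
begin

lemma equalizer_arr:
  assumes "is_equalizer C m f g"
  shows "f \<in> Arr C" "g \<in> Arr C" "m \<in> Arr C" "Dom C g = Dom C f" "Cod C g = Cod C f"
    "Cod C m = Dom C f" "f \<cdot> m = g \<cdot> m"
  using assms by (auto simp: is_equalizer_def hom_def)

lemma equalizer_lift:
  assumes "is_equalizer C m f g" "x \<in> Arr C" "Cod C x = Dom C f" "f \<cdot> x = g \<cdot> x"
  obtains h where "h \<in> Arr C" "Dom C h = Dom C x" "Cod C h = Dom C m" "m \<cdot> h = x"
proof -
  have "\<exists>!h. h \<in> hom C (Dom C x) (Dom C m) \<and> m \<cdot> h = x"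
    using assms by (auto simp: is_equalizer_def hom_iff)
  then show ?thesis using that by (auto simp: hom_iff)
qed

lemma regular_mono_arr: "is_regular_mono C m \<Longrightarrow> m \<in> Arr C"
  by (auto simp: is_regular_mono_def dest: equalizer_arr)

lemma regular_mono_cancel:
  assumes "is_regular_mono C m" "x \<in> Arr C" "y \<in> Arr C" "Dom C x = Dom C y"
    "Cod C x = Dom C m" "Cod C y = Dom C m" "m \<cdot> x = m \<cdot> y"
  shows "x = y"
proof -
  obtain f g where eq: "is_equalizer C m f g"
    using assms(1) by (auto simp: is_regular_mono_def)
  note t = equalizer_arr[OF eq]
  have "f \<cdot> (m \<cdot> x) = g \<cdot> (m \<cdot> x)"
    using t assms comp_assoc[of x m f] comp_assoc[of x m g] by simp
  moreover have "m \<cdot> x \<in> hom C (Dom C x) (Dom C f)"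
    using t assms by (auto simp: hom_iff)
  ultimately have "\<exists>!h. h \<in> hom C (Dom C x) (Dom C m) \<and> m \<cdot> h = m \<cdot> x"
    using eq unfolding is_equalizer_def by blast
  then show ?thesis using assms unfolding hom_iff by metis
qed

lemma equalizerI:
  assumes "f \<in> Arr C" "g \<in> Arr C" "m \<in> Arr C" "Dom C g = Dom C f" "Cod C g = Cod C f"
    "Cod C m = Dom C f" "f \<cdot> m = g \<cdot> m"
    and "\<And>x. \<lbrakk>x \<in> Arr C; Cod C x = Dom C f; f \<cdot> x = g \<cdot> x\<rbrakk> \<Longrightarrow>
      \<exists>h. h \<in> Arr C \<and> Dom C h = Dom C x \<and> Cod C h = Dom C m \<and> m \<cdot> h = x"
    and "\<And>h h'. \<lbrakk>h \<in> Arr C; h' \<in> Arr C; Dom C h = Dom C h'; Cod C h = Dom C m; Cod C h' = Dom C m;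
      m \<cdot> h = m \<cdot> h'\<rbrakk> \<Longrightarrow> h = h'"
  shows "is_equalizer C m f g"
  unfolding is_equalizer_def hom_iff
proof (intro conjI allI impI)
  fix X x
  assume "(x \<in> Arr C \<and> Dom C x = X \<and> Cod C x = Dom C f) \<and> f \<cdot> x = g \<cdot> x"
  then obtain h where h: "h \<in> Arr C \<and> Dom C h = X \<and> Cod C h = Dom C m \<and> m \<cdot> h = x"
    using assms(8)[of x] by metis
  show "\<exists>!h. (h \<in> Arr C \<and> Dom C h = X \<and> Cod C h = Dom C m) \<and> m \<cdot> h = x"
  proof (rule ex1I)
    show "(h \<in> Arr C \<and> Dom C h = X \<and> Cod C h = Dom C m) \<and> m \<cdot> h = x"
      using h by simp
  next
    fix k
    assume "(k \<in> Arr C \<and> Dom C k = X \<and> Cod C k = Dom C m) \<and> m \<cdot> k = x"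
    with h show "k = h" by - (rule assms(9), simp_all)
  qed
qed (simp_all add: assms(1-7))

text \<open>The arrow \<open>m\<close> is the equalizer of the identity and the idempotent
  \<open>m \<cdot> s\<close>; an arrow \<open>x\<close> equalizing these factors through
  \<open>m\<close> by \<open>s \<cdot> x\<close>.\<close>

lemma split_mono_regular:
  assumes "m \<in> Arr C" "s \<in> Arr C" "Dom C s = Cod C m" "Cod C s = Dom C m" "s \<cdot> m = Idt C (Dom C m)"
  shows "is_regular_mono C m"
proof -
  have "is_equalizer C m (Idt C (Cod C m)) (m \<cdot> s)"
  proof (rule equalizerI)
    fix x assume x: "x \<in> Arr C" "Cod C x = Dom C (Idt C (Cod C m))" "Idt C (Cod C m) \<cdot> x = m \<cdot> s \<cdot> x"
    have "m \<cdot> (s \<cdot> x) = x"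
      using x(3)[symmetric] x(1,2) assms(1-4) by simp
    then show "\<exists>h. h \<in> Arr C \<and> Dom C h = Dom C x \<and> Cod C h = Dom C m \<and> m \<cdot> h = x"
      using x(1,2) assms(1-4) by (intro exI[of _ "s \<cdot> x"]) simp
  next
    fix h h'
    assume h: "h \<in> Arr C" "h' \<in> Arr C" "Dom C h = Dom C h'" "Cod C h = Dom C m" "Cod C h' = Dom C m"
      "m \<cdot> h = m \<cdot> h'"
    have "s \<cdot> (m \<cdot> h) = h" "s \<cdot> (m \<cdot> h') = h'"
      using assms(1-4) h(1-5) comp_extend[OF assms(5), of h] comp_extend[OF assms(5), of h'] by simp_all
    then show "h = h'" using h(6) by metis
  qed (use assms in auto)
  then show ?thesis by (auto simp: is_regular_mono_def)
qed

text \<open>If \<open>g\<close> is the equalizer of \<open>a\<close> and \<open>b\<close>, then its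
  pullback along \<open>f\<close> is the equalizer of \<open>a \<cdot> f\<close> and
  \<open>b \<cdot> f\<close>.\<close>

lemma pullback_regular_mono:
  assumes "is_pullback C p q f g" "is_regular_mono C g"
  shows "is_regular_mono C p"
proof -
  obtain a b where eq: "is_equalizer C g a b"
    using assms(2) by (auto simp: is_regular_mono_def)
  note t = equalizer_arr[OF eq] pullback_arr[OF assms(1)]
  have "is_equalizer C p (a \<cdot> f) (b \<cdot> f)"
  proof (rule equalizerI)
    show "a \<cdot> f \<cdot> p = b \<cdot> f \<cdot> p"
      using t comp_assoc[of q g a] comp_assoc[of q g b] by simp
  next
    fix x assume x: "x \<in> Arr C" "Cod C x = Dom C (a \<cdot> f)" "a \<cdot> f \<cdot> x = b \<cdot> f \<cdot> x"
    obtain y where y: "y \<in> Arr C" "Dom C y = Dom C (f \<cdot> x)" "Cod C y = Dom C g" "g \<cdot> y = f \<cdot> x"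
      by (rule equalizer_lift[OF eq, of "f \<cdot> x"]) (use x t in auto)
    obtain h where "h \<in> Arr C" "Dom C h = Dom C x" "Cod C h = Dom C p" "p \<cdot> h = x" "q \<cdot> h = y"
      by (rule pullback_lift[OF assms(1), of x y]) (use x y t in auto)
    then show "\<exists>h. h \<in> Arr C \<and> Dom C h = Dom C x \<and> Cod C h = Dom C p \<and> p \<cdot> h = x" by blast
  next
    fix h h'
    assume h: "h \<in> Arr C" "h' \<in> Arr C" "Dom C h = Dom C h'" "Cod C h = Dom C p" "Cod C h' = Dom C p"
      "p \<cdot> h = p \<cdot> h'"
    have gq: "g \<cdot> (q \<cdot> h) = g \<cdot> (q \<cdot> h')"
      using t h comp_extend[of f p "g \<cdot> q" h] comp_extend[of f p "g \<cdot> q" h'] by simp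
    have qh: "q \<cdot> h = q \<cdot> h'"
      by (rule regular_mono_cancel[OF assms(2)]) (use h t gq in auto)
    show "h = h'"
      by (rule pullback_eqI[OF assms(1)]) (use h t qh in auto)
  qed (use t in auto)
  then show ?thesis by (auto simp: is_regular_mono_def)
qed

text \<open>An arrow that already factors through the mono \<open>m\<close> pulls back to its
  factor. This supplies the pullbacks over which the exponential of the partial map classifier is
  transposed.\<close>

lemma pullback_of_subobject:
  assumes "is_regular_mono C m" "f \<in> Arr C" "Cod C f = Dom C m"
  shows "is_pullback C (Idt C (Dom C f)) f (m \<cdot> f) m"
proof (rule pullbackI)
  fix x y
  assume xy: "x \<in> Arr C" "y \<in> Arr C" "Dom C x = Dom C y" "Cod C x = Dom C (m \<cdot> f)" "Cod C y = Dom C m"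
    "m \<cdot> f \<cdot> x = m \<cdot> y"
  have "f \<cdot> x = y"
    by (rule regular_mono_cancel[OF assms(1)]) (use xy assms regular_mono_arr[OF assms(1)] in auto)
  then show "\<exists>h. h \<in> Arr C \<and> Dom C h = Dom C x \<and> Cod C h = Dom C (Idt C (Dom C f)) \<and>
      Idt C (Dom C f) \<cdot> h = x \<and> f \<cdot> h = y"
    using xy assms regular_mono_arr[OF assms(1)] by (intro exI[of _ x]) auto
qed (use assms regular_mono_arr[OF assms(1)] in auto)

end

section \<open>Partial map classifiers\<close>

lemma slice_hom_iff:
  "u \<in> hom (slice C X) a b \<longleftrightarrow> (\<exists>h. u = (a, h, b) \<and> a \<in> Arr C \<and> b \<in> Arr C \<and> Cod C a = X \<and>
     Cod C b = X \<and> h \<in> hom C (Dom C a) (Dom C b) \<and> b \<cdot>\<^bsub>C\<^esub> h = a)"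
  by (auto simp: slice_def hom_def)

lemma slice_comp [simp]: "(b, k, c) \<cdot>\<^bsub>slice C X\<^esub> (a, h, b') = (a, k \<cdot>\<^bsub>C\<^esub> h, c)"
  by (simp add: slice_def)

text \<open>A cone \<open>(u, v)\<close> over \<open>(x, a)\<close> is a pair of slice arrows out of
  the object \<open>x \<cdot> u\<close>, to which the product property applies.\<close>

lemma (in category) slice_product_pullback:
  assumes "is_product (slice C X) x a P pp qq"
  obtains p q where "pp = (P, p, x)" "qq = (P, q, a)" "x \<cdot> p = P" "is_pullback C p q x a"
proof -
  let ?S = "slice C X"
  have "pp \<in> hom ?S P x" "qq \<in> hom ?S P a"
    using assms by (auto simp: is_product_def)
  then obtain p q where pq: "pp = (P, p, x)" "qq = (P, q, a)" and P: "P \<in> Arr C" "x \<in> Arr C" "a \<in> Arr C"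
    "Cod C P = X" "Cod C x = X" "Cod C a = X" and p: "p \<in> Arr C" "Dom C p = Dom C P" "Cod C p = Dom C x" "x \<cdot> p = P"
    and q: "q \<in> Arr C" "Dom C q = Dom C P" "Cod C q = Dom C a" "a \<cdot> q = P"
    unfolding slice_hom_iff hom_iff[where C=C] by blast
  have univ: "\<exists>!h. h \<in> hom ?S Y P \<and> pp \<cdot>\<^bsub>?S\<^esub> h = u \<and> qq \<cdot>\<^bsub>?S\<^esub> h = v"
    if "u \<in> hom ?S Y x" "v \<in> hom ?S Y a" for Y u v
    using assms that unfolding is_product_def by blast
  have "is_pullback C p q x a"
  proof (rule pullbackI)
    fix u v
    assume uv: "u \<in> Arr C" "v \<in> Arr C" "Dom C u = Dom C v" "Cod C u = Dom C x" "Cod C v = Dom C a" "x \<cdot> u = a \<cdot> v"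
    have "(x \<cdot> u, u, x) \<in> hom ?S (x \<cdot> u) x" "(x \<cdot> u, v, a) \<in> hom ?S (x \<cdot> u) a"
      using uv P by (auto simp: slice_hom_iff hom_iff[where C=C])
    from univ[OF this] obtain h where "h \<in> hom ?S (x \<cdot> u) P" "pp \<cdot>\<^bsub>?S\<^esub> h = (x \<cdot> u, u, x)"
        "qq \<cdot>\<^bsub>?S\<^esub> h = (x \<cdot> u, v, a)" by blast
    then obtain h' where h': "h' \<in> hom C (Dom C (x \<cdot> u)) (Dom C P)" "p \<cdot> h' = u" "q \<cdot> h' = v"
      unfolding slice_hom_iff pq by auto
    then show "\<exists>h. h \<in> Arr C \<and> Dom C h = Dom C u \<and> Cod C h = Dom C p \<and> p \<cdot> h = u \<and> q \<cdot> h = v"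
      using uv(1-5) P(2) p(2) by (intro exI[of _ h']) (simp add: hom_iff)
  next
    fix h h'
    assume h: "h \<in> Arr C" "h' \<in> Arr C" "Dom C h = Dom C h'" "Cod C h = Dom C p" "Cod C h' = Dom C p"
      "p \<cdot> h = p \<cdot> h'" "q \<cdot> h = q \<cdot> h'"
    \<comment> \<open>Since \<open>P = x \<cdot> p\<close>, the two arrows induce the same structure
      arrow. They thus become slice arrows with a common domain and can be compared there.\<close>
    have P_eq: "P \<cdot> h' = P \<cdot> h"
      using comp_assoc[of h p x] comp_assoc[of h' p x] h p P by simp
    have "(P \<cdot> h, p \<cdot> h, x) \<in> hom ?S (P \<cdot> h) x" "(P \<cdot> h, q \<cdot> h, a) \<in> hom ?S (P \<cdot> h) a"
      using h(1-5) P p q comp_extend[OF p(4), of h] comp_extend[OF q(4), of h]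
      by (auto simp: slice_hom_iff hom_iff[where C=C])
    note ex1 = univ[OF this]
    have "(P \<cdot> h, h, P) \<in> hom ?S (P \<cdot> h) P" "(P \<cdot> h, h', P) \<in> hom ?S (P \<cdot> h) P"
      using h(1-5) P p P_eq by (auto simp: slice_hom_iff hom_iff[where C=C])
    moreover have "pp \<cdot>\<^bsub>?S\<^esub> (P \<cdot> h, h, P) = (P \<cdot> h, p \<cdot> h, x)" "qq \<cdot>\<^bsub>?S\<^esub> (P \<cdot> h, h, P) = (P \<cdot> h, q \<cdot> h, a)"
      "pp \<cdot>\<^bsub>?S\<^esub> (P \<cdot> h, h', P) = (P \<cdot> h, p \<cdot> h, x)" "qq \<cdot>\<^bsub>?S\<^esub> (P \<cdot> h, h', P) = (P \<cdot> h, q \<cdot> h, a)"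
      using h(6,7) by (simp_all add: pq)
    ultimately have "(P \<cdot> h, h, P) = (P \<cdot> h, h', P)"
      using ex1 by blast
    then show "h = h'" by simp
  qed (use P p q in auto)
  then show ?thesis by (rule that[OF pq p(4)])
qed

text \<open>Exponentials are tested against products in the slice; this turns any pullback along
  \<open>a\<close> into such a test product.\<close>

lemma (in category) pullback_slice_product:
  assumes "is_pullback C p q x a" "Cod C a = X"
  shows "is_product (slice C X) x a (x \<cdot> p) (x \<cdot> p, p, x) (x \<cdot> p, q, a)"
proof -
  let ?S = "slice C X"
  note t = pullback_arr[OF assms(1)] assms(2)
  show ?thesis
    unfolding is_product_def
  proof (intro conjI allI impI)
    show "(x \<cdot> p, p, x) \<in> hom ?S (x \<cdot> p) x" "(x \<cdot> p, q, a) \<in> hom ?S (x \<cdot> p) a"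
      using t by (auto simp: slice_hom_iff hom_iff[where C=C])
  next
    fix Y u v
    assume "u \<in> hom ?S Y x \<and> v \<in> hom ?S Y a"
    then obtain u' v' where uv: "u = (Y, u', x)" "v = (Y, v', a)" "Y \<in> Arr C" "Cod C Y = X"
      "u' \<in> Arr C" "v' \<in> Arr C" "Dom C u' = Dom C Y" "Dom C v' = Dom C Y" "Cod C u' = Dom C x" "Cod C v' = Dom C a"
      "x \<cdot> u' = Y" "a \<cdot> v' = Y"
      unfolding slice_hom_iff hom_iff[where C=C] by blast
    obtain h where h: "h \<in> Arr C" "Dom C h = Dom C u'" "Cod C h = Dom C p" "p \<cdot> h = u'" "q \<cdot> h = v'"
      by (rule pullback_lift[OF assms(1), of u' v']) (use uv in auto)
    show "\<exists>!h. h \<in> hom ?S Y (x \<cdot> p) \<and> (x \<cdot> p, p, x) \<cdot>\<^bsub>?S\<^esub> h = u \<and> (x \<cdot> p, q, a) \<cdot>\<^bsub>?S\<^esub> h = v"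
    proof (rule ex1I)
      show "(Y, h, x \<cdot> p) \<in> hom ?S Y (x \<cdot> p) \<and> (x \<cdot> p, p, x) \<cdot>\<^bsub>?S\<^esub> (Y, h, x \<cdot> p) = u \<and>
          (x \<cdot> p, q, a) \<cdot>\<^bsub>?S\<^esub> (Y, h, x \<cdot> p) = v"
        using h uv t(1-8,10) by (auto simp: slice_hom_iff hom_iff[where C=C])
    next
      fix k
      assume "k \<in> hom ?S Y (x \<cdot> p) \<and> (x \<cdot> p, p, x) \<cdot>\<^bsub>?S\<^esub> k = u \<and> (x \<cdot> p, q, a) \<cdot>\<^bsub>?S\<^esub> k = v"
      moreover from this obtain k' where k: "k = (Y, k', x \<cdot> p)" "k' \<in> Arr C" "Dom C k' = Dom C Y"
          "Cod C k' = Dom C (x \<cdot> p)"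
        unfolding slice_hom_iff hom_iff[where C=C] by blast
      ultimately have k': "p \<cdot> k' = u'" "q \<cdot> k' = v'"
        by (simp_all add: uv(1,2))
      have "k' = h"
        by (rule pullback_eqI[OF assms(1)]) (use k(2-4) k' h uv(5-8) t(1-8) in simp_all)
      then show "k = (Y, h, x \<cdot> p)" by (simp add: k(1))
    qed
  qed
qed

section \<open>Pushouts, slice exponentials, products and equalizers in a quasitopos\<close>

context quasitopos
begin

lemma pullback_ex:
  assumes "f \<in> Arr C" "g \<in> Arr C" "Cod C f = Cod C g"
  obtains p q where "is_pullback C p q f g"
  using pullback_exists[OF category_axioms finite_limits assms] .

lemma pushout_ex:
  assumes "f \<in> Arr C" "g \<in> Arr C" "Dom C f = Dom C g"
  obtains i j where "is_pushout C f g i j"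
  using pullback_exists[OF category_opposite[OF category_axioms] finite_colimits[unfolded has_finite_colimits_def], of f g]
    assms by (auto simp: pushout_iff_pullback_opposite)

text \<open>The arrow \<open>\<epsilon>\<close> is the exponential of base \<open>b\<close> and
  exponent \<open>a\<close> in the slice over \<open>Cod C a\<close>. Its universal property is
  restated without slice triples, with pullbacks along \<open>a\<close> in place of products with
  \<open>a\<close>; \<open>h\<close> is the transpose of \<open>g\<close>, and \<open>k\<close> is
  the arrow induced by \<open>h\<close> between the pullbacks.\<close>

lemma slice_exponential:
  assumes "a \<in> Arr C" "b \<in> Arr C" "Cod C b = Cod C a"
  obtains \<epsilon> p q ev where "is_pullback C p q \<epsilon> a"
    "ev \<in> Arr C" "Dom C ev = Dom C p" "Cod C ev = Dom C b" "b \<cdot> ev = \<epsilon> \<cdot> p"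
    "\<And>x p' q' g. \<lbrakk>is_pullback C p' q' x a; g \<in> Arr C; Dom C g = Dom C p'; Cod C g = Dom C b; b \<cdot> g = x \<cdot> p'\<rbrakk> \<Longrightarrow>
      \<exists>!h. h \<in> hom C (Dom C x) (Dom C \<epsilon>) \<and> \<epsilon> \<cdot> h = x \<and>
        (\<exists>k. k \<in> hom C (Dom C p') (Dom C p) \<and> p \<cdot> k = h \<cdot> p' \<and> q \<cdot> k = q' \<and> ev \<cdot> k = g)"
proof -
  let ?S = "slice C (Cod C a)"
  have "a \<in> Obj ?S" "b \<in> Obj ?S"
    using assms by (auto simp: slice_def)
  moreover have "cartesian_closed ?S"
    using loc_cart_closed assms by (simp add: locally_cartesian_closed_def)
  ultimately obtain \<epsilon> P pp qq eev where ex: "is_exponential ?S a b \<epsilon> P pp qq eev"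
    unfolding cartesian_closed_def by blast
  then have prod: "is_product ?S \<epsilon> a P pp qq" and e: "eev \<in> hom ?S P b"
    by (auto simp: is_exponential_def)
  obtain p q where pq: "pp = (P, p, \<epsilon>)" "qq = (P, q, a)" "\<epsilon> \<cdot> p = P" and pb: "is_pullback C p q \<epsilon> a"
    by (rule slice_product_pullback[OF prod])
  note t = pullback_arr[OF pb]
  obtain ev where ev: "eev = (P, ev, b)" "ev \<in> Arr C" "Dom C ev = Dom C p" "Cod C ev = Dom C b" "b \<cdot> ev = \<epsilon> \<cdot> p"
    using e pq(3) t by (auto simp: slice_hom_iff hom_iff[where C=C])
  have "\<exists>!h. h \<in> hom C (Dom C x) (Dom C \<epsilon>) \<and> \<epsilon> \<cdot> h = x \<and>
        (\<exists>k. k \<in> hom C (Dom C p') (Dom C p) \<and> p \<cdot> k = h \<cdot> p' \<and> q \<cdot> k = q' \<and> ev \<cdot> k = g)"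
    (is "\<exists>!h. ?Q h")
    if pb': "is_pullback C p' q' x a" and g: "g \<in> Arr C" "Dom C g = Dom C p'" "Cod C g = Dom C b" "b \<cdot> g = x \<cdot> p'"
    for x p' q' g
  proof -
    note t' = pullback_arr[OF pb']
    have "(x \<cdot> p', g, b) \<in> hom ?S (x \<cdot> p') b"
      using g t' assms by (auto simp: slice_hom_iff hom_iff[where C=C])
    then have "\<exists>!h. h \<in> hom ?S x \<epsilon> \<and> (\<exists>k. k \<in> hom ?S (x \<cdot> p') P \<and> pp \<cdot>\<^bsub>?S\<^esub> k = h \<cdot>\<^bsub>?S\<^esub> (x \<cdot> p', p', x) \<and>
        qq \<cdot>\<^bsub>?S\<^esub> k = (x \<cdot> p', q', a) \<and> eev \<cdot>\<^bsub>?S\<^esub> k = (x \<cdot> p', g, b))" (is "\<exists>!h. ?R h")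
      using ex pullback_slice_product[OF pb' refl] unfolding is_exponential_def by blast
    \<comment> \<open>Every slice arrow from \<open>x\<close> to \<open>\<epsilon>\<close> is a
      triple \<open>(x, h, \<epsilon>)\<close>, so this equivalence carries unique existence over
      from triples to their middle components.\<close>
    moreover have R: "?R (x, h, \<epsilon>) \<longleftrightarrow> ?Q h" for h
    proof
      assume "?R (x, h, \<epsilon>)"
      then obtain k where h: "h \<in> hom C (Dom C x) (Dom C \<epsilon>)" "\<epsilon> \<cdot> h = x"
        and k: "k \<in> hom C (Dom C (x \<cdot> p')) (Dom C P)" "p \<cdot> k = h \<cdot> p'" "q \<cdot> k = q'" "ev \<cdot> k = g"
        unfolding slice_hom_iff pq(1,2) ev(1) by auto
      moreover have "Dom C (x \<cdot> p') = Dom C p'" "Dom C P = Dom C p"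
        using t(1-8) t'(1-8) pq(3)[symmetric] by simp_all
      ultimately show "?Q h" by auto
    next
      assume Q: "?Q h"
      then obtain k where h: "h \<in> hom C (Dom C x) (Dom C \<epsilon>)" "\<epsilon> \<cdot> h = x"
        and k: "k \<in> Arr C" "Dom C k = Dom C p'" "Cod C k = Dom C p" "p \<cdot> k = h \<cdot> p'" "q \<cdot> k = q'" "ev \<cdot> k = g"
        by (auto simp: hom_iff)
      \<comment> \<open>For \<open>k\<close> to be a slice arrow it has to commute with the
        structure arrows \<open>x \<cdot> p'\<close> and \<open>P\<close>.\<close>
      have "P \<cdot> k = \<epsilon> \<cdot> (p \<cdot> k)" using pq(3)[symmetric] k(1-3) t(1-8) by simp
      also have "\<dots> = x \<cdot> p'"
        using comp_extend[OF h(2), of p'] k(4) h(1) t(1-8) t'(1-8) by (simp add: hom_iff)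
      finally have "(x \<cdot> p', k, P) \<in> hom ?S (x \<cdot> p') P"
        using t(1-8) t'(1-8) k(1-3) pq(3)[symmetric] by (simp add: slice_hom_iff hom_iff[where C=C])
      then show "?R (x, h, \<epsilon>)"
        using h k t(1-8) t'(1-8) by (auto simp: slice_hom_iff pq(1,2) ev(1))
    qed
    moreover have "\<exists>h'. h = (x, h', \<epsilon>)" if "?R h" for h
      using that by (auto simp: slice_hom_iff)
    ultimately show ?thesis by (smt (verit) prod.inject)
  qed
  then show ?thesis using that[OF pb ev(2-5)] by blast
qed

lemma terminal_ex:
  obtains T where "is_terminal C T"
  using classifier by (auto simp: is_regular_subobject_classifier_def)

end

lemma terminal_arr:
  assumes "is_terminal C T" "A \<in> Obj C"
  obtains t where "t \<in> Arr C" "Dom C t = A" "Cod C t = T"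
  using assms by (auto simp: is_terminal_def hom_iff)

lemma (in category) terminal_eqI:
  assumes "is_terminal C T" "f \<in> Arr C" "g \<in> Arr C" "Dom C f = Dom C g" "Cod C f = T" "Cod C g = T"
  shows "f = g"
proof -
  have "\<exists>!h. h \<in> hom C (Dom C f) T"
    using assms by (simp add: is_terminal_def)
  moreover have "f \<in> hom C (Dom C f) T" "g \<in> hom C (Dom C f) T"
    using assms by (simp_all add: hom_iff)
  ultimately show ?thesis by blast
qed

lemma product_arr:
  assumes "is_product C A B P p q"
  shows "p \<in> Arr C" "q \<in> Arr C" "Dom C p = P" "Dom C q = P" "Cod C p = A" "Cod C q = B"
  using assms by (auto simp: is_product_def hom_iff)

lemma product_lift:
  assumes "is_product C A B P p q" "x \<in> Arr C" "y \<in> Arr C" "Dom C x = Dom C y" "Cod C x = A" "Cod C y = B"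
  obtains h where "h \<in> Arr C" "Dom C h = Dom C x" "Cod C h = P" "p \<cdot>\<^bsub>C\<^esub> h = x" "q \<cdot>\<^bsub>C\<^esub> h = y"
proof -
  have "x \<in> hom C (Dom C x) A" "y \<in> hom C (Dom C x) B"
    using assms by (simp_all add: hom_iff)
  then have "\<exists>!h. h \<in> hom C (Dom C x) P \<and> p \<cdot>\<^bsub>C\<^esub> h = x \<and> q \<cdot>\<^bsub>C\<^esub> h = y"
    using assms(1) unfolding is_product_def by blast
  then show ?thesis using that by (auto simp: hom_iff)
qed

lemma (in category) product_eqI:
  assumes "is_product C A B P p q" "h \<in> Arr C" "h' \<in> Arr C" "Dom C h = Dom C h'" "Cod C h = P" "Cod C h' = P"
    "p \<cdot> h = p \<cdot> h'" "q \<cdot> h = q \<cdot> h'"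
  shows "h = h'"
proof -
  have "p \<cdot> h \<in> hom C (Dom C h) A" "q \<cdot> h \<in> hom C (Dom C h) B"
    using assms(2,5) product_arr[OF assms(1)] by (simp_all add: hom_iff)
  then have "\<exists>!k. k \<in> hom C (Dom C h) P \<and> p \<cdot> k = p \<cdot> h \<and> q \<cdot> k = q \<cdot> h"
    using assms(1) unfolding is_product_def by blast
  then show ?thesis using assms(2-) unfolding hom_iff by metis
qed

context quasitopos
begin

lemma product_ex:
  assumes "A \<in> Obj C" "B \<in> Obj C"
  obtains P p q where "is_product C A B P p q"
proof -
  obtain T where T: "is_terminal C T" by (rule terminal_ex)
  obtain a where a: "a \<in> Arr C" "Dom C a = A" "Cod C a = T" by (rule terminal_arr[OF T assms(1)])
  obtain b where b: "b \<in> Arr C" "Dom C b = B" "Cod C b = T" by (rule terminal_arr[OF T assms(2)])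
  obtain p q where pb: "is_pullback C p q a b"
    by (rule pullback_ex[of a b]) (use a b in auto)
  have "a \<cdot> x = b \<cdot> y" if "x \<in> hom C X A" "y \<in> hom C X B" for X x y
    by (rule terminal_eqI[OF T]) (use that a b in \<open>auto simp: hom_iff\<close>)
  then have "is_product C A B (Dom C p) p q"
    using pb a b unfolding is_pullback_def is_product_def by (simp add: hom_iff)
  then show ?thesis by (rule that)
qed

text \<open>The equalizer is the pullback of the graphs \<open>u = (1, f)\<close> and
  \<open>v = (1, g)\<close>.\<close>

lemma equalizer_ex:
  assumes "f \<in> Arr C" "g \<in> Arr C" "Dom C g = Dom C f" "Cod C g = Cod C f"
  obtains m where "is_equalizer C m f g"
proof -
  let ?I = "Idt C (Dom C f)"
  obtain P p q where prod: "is_product C (Dom C f) (Cod C f) P p q"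
    by (rule product_ex[of "Dom C f" "Cod C f"]) (use assms in auto)
  note pq = product_arr[OF prod]
  obtain u where u: "u \<in> Arr C" "Dom C u = Dom C f" "Cod C u = P" "p \<cdot> u = ?I" "q \<cdot> u = f"
    by (rule product_lift[OF prod, of ?I f]) (use assms in auto)
  obtain v where v: "v \<in> Arr C" "Dom C v = Dom C f" "Cod C v = P" "p \<cdot> v = ?I" "q \<cdot> v = g"
    by (rule product_lift[OF prod, of ?I g]) (use assms in auto)
  have up: "p \<cdot> (u \<cdot> x) = x" "q \<cdot> (u \<cdot> x) = f \<cdot> x" "p \<cdot> (v \<cdot> x) = x" "q \<cdot> (v \<cdot> x) = g \<cdot> x"
    if "x \<in> Arr C" "Cod C x = Dom C f" for x
    using comp_extend[OF u(4), of x] comp_extend[OF u(5), of x] comp_extend[OF v(4), of x] comp_extend[OF v(5), of x]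
      that u(1-3) v(1-3) pq by simp_all
  obtain m n where pb: "is_pullback C m n u v"
    by (rule pullback_ex[of u v]) (use u v in auto)
  note t = pullback_arr[OF pb]
  \<comment> \<open>Comparing first components shows that both legs of the pullback
    coincide.\<close>
  have nm: "n = m"
    using up(1)[of m] up(3)[of n] t u(2) v(2) by simp
  have "is_equalizer C m f g"
  proof (rule equalizerI)
    show "f \<cdot> m = g \<cdot> m"
      using up(2)[of m] up(4)[of m] t u(2) unfolding nm by simp
  next
    fix x assume x: "x \<in> Arr C" "Cod C x = Dom C f" "f \<cdot> x = g \<cdot> x"
    have "u \<cdot> x = v \<cdot> x"
      by (rule product_eqI[OF prod]) (use x u(1-3) v(1-3) up[of x] in simp_all)
    then obtain h where "h \<in> Arr C" "Dom C h = Dom C x" "Cod C h = Dom C m" "m \<cdot> h = x"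
      by - (rule pullback_lift[OF pb, of x x], use x u(2) v(2) in auto)
    then show "\<exists>h. h \<in> Arr C \<and> Dom C h = Dom C x \<and> Cod C h = Dom C m \<and> m \<cdot> h = x" by blast
  next
    fix h h'
    assume "h \<in> Arr C" "h' \<in> Arr C" "Dom C h = Dom C h'" "Cod C h = Dom C m" "Cod C h' = Dom C m" "m \<cdot> h = m \<cdot> h'"
    then show "h = h'"
      by - (rule pullback_eqI[OF pb], simp_all add: nm)
  qed (use assms t u(2) in auto)
  then show ?thesis by (rule that)
qed

end

text \<open>In the slice over \<open>Cod C f\<close>, the pair \<open>(n, g)\<close> is a partial
  map from \<open>\<alpha>\<close> to \<open>f\<close> defined on a regular subobject, and
  \<open>\<beta>\<close> is its classifying arrow. If \<open>g\<close> is an identity, this is the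
  universal property of materializations; if \<open>Cod C f\<close> is terminal, it is that of the
  partial map classifier of the object \<open>Dom C f\<close>.\<close>

definition classifies_partial_maps :: "('o, 'm) category \<Rightarrow> 'm \<Rightarrow> 'm \<Rightarrow> 'm \<Rightarrow> bool" where
  "classifies_partial_maps C f f' f'' \<longleftrightarrow>
     (\<forall>n g \<alpha>. is_regular_mono C n \<and> g \<in> Arr C \<and> \<alpha> \<in> Arr C \<and> Dom C g = Dom C n \<and> Cod C g = Dom C f \<and>
        Dom C \<alpha> = Cod C n \<and> Cod C \<alpha> = Cod C f \<and> \<alpha> \<cdot>\<^bsub>C\<^esub> n = f \<cdot>\<^bsub>C\<^esub> g \<longrightarrow>
      (\<exists>!\<beta>. \<beta> \<in> hom C (Cod C n) (Cod C f') \<and> f'' \<cdot>\<^bsub>C\<^esub> \<beta> = \<alpha> \<and> is_pullback C n g \<beta> f'))"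

section \<open>Classifiers of regular partial maps and their consequences\<close>

context quasitopos
begin

lemma classifying_arr:
  assumes "is_regular_subobject_classifier C tr" "is_regular_mono C m"
  obtains \<chi> u where "\<chi> \<in> Arr C" "Dom C \<chi> = Cod C m" "Cod C \<chi> = Cod C tr" "is_pullback C m u \<chi> tr"
proof -
  have "\<exists>!\<chi>. \<chi> \<in> hom C (Cod C m) (Cod C tr) \<and>
      (\<exists>t. t \<in> hom C (Dom C m) (Dom C tr) \<and> is_pullback C m t \<chi> tr)"
    using assms unfolding is_regular_subobject_classifier_def by blast
  then show ?thesis using that by (auto simp: hom_iff)
qed

lemma classifying_arr_unique:
  assumes "is_regular_subobject_classifier C tr" "is_regular_mono C m"
    and "is_pullback C m u \<chi> tr" "is_pullback C m u' \<chi>' tr"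
  shows "\<chi> = \<chi>'"
proof -
  have "\<exists>!\<chi>. \<chi> \<in> hom C (Cod C m) (Cod C tr) \<and>
      (\<exists>t. t \<in> hom C (Dom C m) (Dom C tr) \<and> is_pullback C m t \<chi> tr)"
    using assms unfolding is_regular_subobject_classifier_def by blast
  moreover have "\<chi> \<in> hom C (Cod C m) (Cod C tr)" "u \<in> hom C (Dom C m) (Dom C tr)"
    "\<chi>' \<in> hom C (Cod C m) (Cod C tr)" "u' \<in> hom C (Dom C m) (Dom C tr)"
    using pullback_arr[OF assms(3)] pullback_arr[OF assms(4)] by (auto simp: hom_iff)
  ultimately show ?thesis using assms(3,4) by blast
qed

text \<open>A partial map over \<open>Cod f\<close> into \<open>f\<close> with regular domain \<open>n\<close> is a pair \<open>(n, g)\<close>; the classifier of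
  \<open>f\<close> in the slice over \<open>B = Cod f\<close> is the exponential \<open>(t f)\<^sup>t\<close> in the slice over \<open>B \<times> \<Omega>\<close>, where
  \<open>t = (1, true) : B \<rightarrow> B \<times> \<Omega>\<close>. As \<open>t\<close> is monic, this exponential is the dependent product of \<open>f\<close>
  along \<open>t\<close>.\<close>

lemma partial_map_classifier:
  assumes f: "f \<in> Arr C"
  obtains f' f'' where "f' \<in> Arr C" "Dom C f' = Dom C f" "f'' \<in> Arr C" "Dom C f'' = Cod C f'" "Cod C f'' = Cod C f"
    "f'' \<cdot> f' = f" "is_regular_mono C f'" "classifies_partial_maps C f f' f''"
proof -
  obtain tr where cl: "is_regular_subobject_classifier C tr" using classifier by blast
  then have tr: "tr \<in> Arr C" and trm: "is_terminal C (Dom C tr)"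
    by (auto simp: is_regular_subobject_classifier_def)
  obtain D \<pi>\<^sub>1 \<pi>\<^sub>2 where prod: "is_product C (Cod C f) (Cod C tr) D \<pi>\<^sub>1 \<pi>\<^sub>2"
    by (rule product_ex[of "Cod C f" "Cod C tr"]) (use f tr in simp_all)
  note \<pi> = product_arr[OF prod]
  obtain b where b: "b \<in> Arr C" "Dom C b = Cod C f" "Cod C b = Dom C tr"
    by (rule terminal_arr[OF trm, of "Cod C f"]) (use f in simp_all)
  obtain t where t: "t \<in> Arr C" "Dom C t = Cod C f" "Cod C t = D"
      and \<pi>t: "\<pi>\<^sub>1 \<cdot> t = Idt C (Cod C f)" "\<pi>\<^sub>2 \<cdot> t = tr \<cdot> b"
    by (rule product_lift[OF prod, of "Idt C (Cod C f)" "tr \<cdot> b"]) (use f tr b in simp_all)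
  have t_mono: "is_regular_mono C t"
    by (rule split_mono_regular[of t \<pi>\<^sub>1]) (use t \<pi> \<pi>t in simp_all)
  have \<pi>t_comp: "\<pi>\<^sub>1 \<cdot> (t \<cdot> x) = x" "\<pi>\<^sub>2 \<cdot> (t \<cdot> x) = tr \<cdot> (b \<cdot> x)" if "x \<in> Arr C" "Cod C x = Cod C f" for x
    using comp_extend[OF \<pi>t(1), of x] comp_extend[OF \<pi>t(2), of x] that t \<pi> tr b by simp_all
  \<comment> \<open>As \<open>t\<close> is the pullback of \<open>tr\<close> along
    \<open>\<pi>\<^sub>2\<close>, pulling \<open>t\<close> back along an arrow into \<open>D\<close>
    gives the subobject classified by the second component of that arrow.\<close>
  have t_pb: "is_pullback C b t tr \<pi>\<^sub>2"
  proof (rule pullbackI)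
    fix y x
    assume xy: "y \<in> Arr C" "x \<in> Arr C" "Dom C y = Dom C x" "Cod C y = Dom C tr" "Cod C x = Dom C \<pi>\<^sub>2"
      "tr \<cdot> y = \<pi>\<^sub>2 \<cdot> x"
    have y: "b \<cdot> (\<pi>\<^sub>1 \<cdot> x) = y"
      by (rule terminal_eqI[OF trm]) (use xy(1-5) b \<pi> in simp_all)
    have "t \<cdot> (\<pi>\<^sub>1 \<cdot> x) = x"
      by (rule product_eqI[OF prod]) (use xy t \<pi> y \<pi>t_comp[of "\<pi>\<^sub>1 \<cdot> x"] in simp_all)
    then show "\<exists>h. h \<in> Arr C \<and> Dom C h = Dom C y \<and> Cod C h = Dom C b \<and> b \<cdot> h = y \<and> t \<cdot> h = x"
      using y xy(1-5) \<pi> b by (intro exI[of _ "\<pi>\<^sub>1 \<cdot> x"]) simp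
  next
    fix h h'
    assume h: "h \<in> Arr C" "h' \<in> Arr C" "Dom C h = Dom C h'" "Cod C h = Dom C b" "Cod C h' = Dom C b"
      "b \<cdot> h = b \<cdot> h'" "t \<cdot> h = t \<cdot> h'"
    show "h = h'"
      by (rule regular_mono_cancel[OF t_mono]) (use h b t in simp_all)
  qed (use tr b t \<pi> \<pi>t in simp_all)
  obtain \<epsilon> p q ev where pb: "is_pullback C p q \<epsilon> t"
    and ev: "ev \<in> Arr C" "Dom C ev = Dom C p" "Cod C ev = Dom C (t \<cdot> f)" "t \<cdot> f \<cdot> ev = \<epsilon> \<cdot> p"
    and exp: "\<And>x p' q' g. \<lbrakk>is_pullback C p' q' x t; g \<in> Arr C; Dom C g = Dom C p'; Cod C g = Dom C (t \<cdot> f);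
        t \<cdot> f \<cdot> g = x \<cdot> p'\<rbrakk> \<Longrightarrow>
      \<exists>!h. h \<in> hom C (Dom C x) (Dom C \<epsilon>) \<and> \<epsilon> \<cdot> h = x \<and>
        (\<exists>k. k \<in> hom C (Dom C p') (Dom C p) \<and> p \<cdot> k = h \<cdot> p' \<and> q \<cdot> k = q' \<and> ev \<cdot> k = g)"
    by (rule slice_exponential[of t "t \<cdot> f"]) (use t f in simp_all)
  note pq = pullback_arr[OF pb]
  have \<epsilon>: "\<epsilon> \<in> Arr C" "Cod C \<epsilon> = D" using pq t by simp_all
  have ev_cod: "Cod C ev = Dom C f" using ev(3) t f by simp
  have f_ev: "f \<cdot> ev = q"
    by (rule regular_mono_cancel[OF t_mono]) (use f ev pq t ev_cod in simp_all)
  \<comment> \<open>The arrow \<open>f'\<close> is the transpose of the identity of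
    \<open>Dom C f\<close>: since \<open>t\<close> is monic, the pullback of
    \<open>t \<cdot> f\<close> along \<open>t\<close> has that same domain.\<close>
  obtain f' where f'_hom: "f' \<in> hom C (Dom C (t \<cdot> f)) (Dom C \<epsilon>)" and \<epsilon>f': "\<epsilon> \<cdot> f' = t \<cdot> f"
    and "\<exists>k. k \<in> hom C (Dom C (Idt C (Dom C f))) (Dom C p) \<and> p \<cdot> k = f' \<cdot> Idt C (Dom C f) \<and> q \<cdot> k = f \<and>
      ev \<cdot> k = Idt C (Dom C f)"
    using exp[OF pullback_of_subobject[OF t_mono f], of "Idt C (Dom C f)"] t f by auto
  then obtain k where k: "k \<in> Arr C" "Dom C k = Dom C f" "Cod C k = Dom C p"
    and pk: "p \<cdot> k = f' \<cdot> Idt C (Dom C f)" and qk: "q \<cdot> k = f" and ev_k: "ev \<cdot> k = Idt C (Dom C f)"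
    using f by (auto simp: hom_iff)
  have f': "f' \<in> Arr C" "Dom C f' = Dom C f" "Cod C f' = Dom C \<epsilon>"
    using f'_hom t f by (simp_all add: hom_iff)
  have pk: "p \<cdot> k = f'" using pk f' by simp
  have k_comp: "p \<cdot> (k \<cdot> x) = f' \<cdot> x" "q \<cdot> (k \<cdot> x) = f \<cdot> x" "ev \<cdot> (k \<cdot> x) = x"
    if "x \<in> Arr C" "Cod C x = Dom C f" for x
    using comp_extend[OF pk, of x] comp_extend[OF qk, of x] comp_extend[OF ev_k, of x] that pq(1-8) k ev(1-2) by simp_all
  \<comment> \<open>Both sides are transposes of \<open>ev\<close>, so they agree. Together with
    \<open>ev_k\<close> and \<open>f_ev\<close> this makes \<open>k\<close> and \<open>ev\<close>
    mutually inverse.\<close>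
  have p_eq: "f' \<cdot> ev = p"
  proof -
    let ?I = "Idt C (Dom C q)"
    have I: "?I \<in> Arr C" "Dom C ?I = Dom C p" "Cod C ?I = Dom C p" using pq(1-8) by simp_all
    have "is_pullback C ?I q (t \<cdot> q) t"
      by (rule pullback_of_subobject[OF t_mono]) (use pq in simp_all)
    moreover have tq: "t \<cdot> q = \<epsilon> \<cdot> p" using pq(9) by simp
    ultimately have "\<exists>!h. h \<in> hom C (Dom C (\<epsilon> \<cdot> p)) (Dom C \<epsilon>) \<and> \<epsilon> \<cdot> h = \<epsilon> \<cdot> p \<and>
        (\<exists>k. k \<in> hom C (Dom C ?I) (Dom C p) \<and> p \<cdot> k = h \<cdot> ?I \<and> q \<cdot> k = q \<and> ev \<cdot> k = ev)" (is "\<exists>!h. ?Q h")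
      using exp[of ?I q "\<epsilon> \<cdot> p" ev] ev pq(1-8) I by simp
    moreover have "?Q p"
      using pq(1-8) ev(1,2) I by (intro conjI exI[of _ ?I]) (simp_all add: hom_iff)
    moreover have "?Q (f' \<cdot> ev)"
    proof (intro conjI exI[of _ "k \<cdot> ev"])
      show "\<epsilon> \<cdot> (f' \<cdot> ev) = \<epsilon> \<cdot> p"
        using comp_extend[OF \<epsilon>f', of ev] ev(1,2,4) ev_cod f' \<epsilon>(1) by simp
      show "q \<cdot> (k \<cdot> ev) = q"
        using k_comp(2)[of ev] ev(1) ev_cod f_ev by simp
    qed (use pq(1-8) ev(1,2) I k f' ev_cod k_comp[of ev] in \<open>simp_all add: hom_iff\<close>)
    ultimately show ?thesis by blast
  qed
  \<comment> \<open>Along the isomorphism \<open>ev\<close>, the pullback \<open>(p, q)\<close>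
    becomes \<open>(f', f)\<close>: pulling the dependent product back along the mono
    \<open>t\<close> returns \<open>f\<close>.\<close>
  have f'_pb: "is_pullback C f f' t \<epsilon>"
  proof (rule pullbackI)
    show "t \<cdot> f = \<epsilon> \<cdot> f'" using \<epsilon>f' by simp
  next
    fix y x
    assume xy: "y \<in> Arr C" "x \<in> Arr C" "Dom C y = Dom C x" "Cod C y = Dom C t" "Cod C x = Dom C \<epsilon>" "t \<cdot> y = \<epsilon> \<cdot> x"
    obtain h where h: "h \<in> Arr C" "Dom C h = Dom C x" "Cod C h = Dom C p" "p \<cdot> h = x" "q \<cdot> h = y"
      by (rule pullback_lift[OF pb, of x y]) (use xy in simp_all)
    then show "\<exists>h. h \<in> Arr C \<and> Dom C h = Dom C y \<and> Cod C h = Dom C f \<and> f \<cdot> h = y \<and> f' \<cdot> h = x"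
      using comp_extend[OF f_ev, of h] comp_extend[OF p_eq, of h] f f' ev(1,2) ev_cod xy(3)
      by (intro exI[of _ "ev \<cdot> h"]) simp
  next
    fix h h'
    assume h: "h \<in> Arr C" "h' \<in> Arr C" "Dom C h = Dom C h'" "Cod C h = Dom C f" "Cod C h' = Dom C f"
      "f \<cdot> h = f \<cdot> h'" "f' \<cdot> h = f' \<cdot> h'"
    have "k \<cdot> h = k \<cdot> h'"
      by (rule pullback_eqI[OF pb]) (use h k k_comp[of h] k_comp[of h'] in simp_all)
    then show "h = h'"
      using k_comp(3)[of h] k_comp(3)[of h'] h(1-5) by metis
  qed (use f f' t \<epsilon> in simp_all)
  have f'_mono: "is_regular_mono C f'"
    by (rule pullback_regular_mono[OF pullback_sym[OF f'_pb] t_mono])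
  \<comment> \<open>Only the component in \<open>Cod C f\<close> of the structure arrow
    \<open>\<epsilon>\<close> is kept; the truth value component records where a partial map is
    defined.\<close>
  let ?f'' = "\<pi>\<^sub>1 \<cdot> \<epsilon>"
  have f'': "?f'' \<in> Arr C" "Dom C ?f'' = Cod C f'" "Cod C ?f'' = Cod C f"
    using \<pi> \<epsilon> f' by simp_all
  have "?f'' \<cdot> f' = f"
    using \<epsilon>f' \<pi>t_comp(1)[of f] \<pi> \<epsilon> f' f by simp
  moreover have "\<exists>!\<beta>. \<beta> \<in> hom C (Cod C n) (Cod C f') \<and> ?f'' \<cdot> \<beta> = \<alpha> \<and> is_pullback C n g \<beta> f'"
    if n: "is_regular_mono C n" and g: "g \<in> Arr C" "Dom C g = Dom C n" "Cod C g = Dom C f"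
      and \<alpha>: "\<alpha> \<in> Arr C" "Dom C \<alpha> = Cod C n" "Cod C \<alpha> = Cod C f" "\<alpha> \<cdot> n = f \<cdot> g"
    for n g \<alpha>
  proof -
    have n_arr: "n \<in> Arr C" by (rule regular_mono_arr[OF n])
    \<comment> \<open>The domain \<open>n\<close> is encoded by its characteristic arrow
      \<open>\<chi>\<close>, and \<open>x = (\<alpha>, \<chi>)\<close> becomes the object over
      \<open>D\<close> from which \<open>g\<close> is transposed.\<close>
    obtain \<chi> u where \<chi>: "\<chi> \<in> Arr C" "Dom C \<chi> = Cod C n" "Cod C \<chi> = Cod C tr" and \<chi>_pb: "is_pullback C n u \<chi> tr"
      by (rule classifying_arr[OF cl n])
    note u = pullback_arr[OF \<chi>_pb]
    obtain x where x: "x \<in> Arr C" "Dom C x = Cod C n" "Cod C x = D" "\<pi>\<^sub>1 \<cdot> x = \<alpha>" "\<pi>\<^sub>2 \<cdot> x = \<chi>"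
      by (rule product_lift[OF prod, of \<alpha> \<chi>]) (use \<alpha> \<chi> in simp_all)
    have u_eq: "u = b \<cdot> (f \<cdot> g)"
      by (rule terminal_eqI[OF trm]) (use u(1-8) b f g in simp_all)
    have tx: "t \<cdot> (f \<cdot> g) = x \<cdot> n"
    proof (rule product_eqI[OF prod])
      show "\<pi>\<^sub>1 \<cdot> (t \<cdot> (f \<cdot> g)) = \<pi>\<^sub>1 \<cdot> (x \<cdot> n)"
        using \<pi>t_comp(1)[of "f \<cdot> g"] comp_extend[OF x(4), of n] f g \<alpha>(4) x(1-3) n_arr \<pi> by simp
      show "\<pi>\<^sub>2 \<cdot> (t \<cdot> (f \<cdot> g)) = \<pi>\<^sub>2 \<cdot> (x \<cdot> n)"
        using \<pi>t_comp(2)[of "f \<cdot> g"] comp_extend[OF x(5), of n] f g x(1-3) n_arr \<pi> u(9) u_eq by simp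
    qed (use t f g x n_arr in simp_all)
    \<comment> \<open>The square classifying \<open>n\<close> factors through \<open>t_pb\<close>
      because \<open>\<pi>\<^sub>2 \<cdot> x = \<chi>\<close>. Cancelling \<open>t_pb\<close> makes
      \<open>n\<close> the pullback of \<open>t\<close> along \<open>x\<close>, so \<open>g\<close>
      has a transpose \<open>\<beta>\<close> over \<open>x\<close>.\<close>
    have x_pb: "is_pullback C (f \<cdot> g) n t x"
      by (rule pullback_cancel[OF t_pb])
        (use pullback_sym[OF \<chi>_pb] u_eq x tx f g b \<pi> in simp_all)
    have "\<exists>!h. h \<in> hom C (Dom C x) (Dom C \<epsilon>) \<and> \<epsilon> \<cdot> h = x \<and>
        (\<exists>k. k \<in> hom C (Dom C n) (Dom C p) \<and> p \<cdot> k = h \<cdot> n \<and> q \<cdot> k = f \<cdot> g \<and> ev \<cdot> k = g)" (is "\<exists>!h. ?Q h")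
      by (rule exp[OF pullback_sym[OF x_pb]]) (use f g t tx in simp_all)
    then obtain \<beta> where Q: "?Q \<beta>" and unique: "\<And>h. ?Q h \<Longrightarrow> h = \<beta>" by blast
    from Q obtain k' where \<beta>: "\<beta> \<in> Arr C" "Dom C \<beta> = Cod C n" "Cod C \<beta> = Dom C \<epsilon>" "\<epsilon> \<cdot> \<beta> = x"
      and k': "k' \<in> Arr C" "Dom C k' = Dom C n" "Cod C k' = Dom C p" "p \<cdot> k' = \<beta> \<cdot> n" "ev \<cdot> k' = g"
      using x(2) by (auto simp: hom_iff)
    have "f' \<cdot> g = \<beta> \<cdot> n"
      using comp_extend[OF p_eq, of k'] k' f' ev(1,2) ev_cod by simp
    then have "is_pullback C g n f' \<beta>"
      by - (rule pullback_cancel[OF f'_pb], use x_pb \<beta> g in simp_all)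
    then have "\<beta> \<in> hom C (Cod C n) (Cod C f') \<and> ?f'' \<cdot> \<beta> = \<alpha> \<and> is_pullback C n g \<beta> f'"
      using \<beta> f' x \<pi> \<epsilon> pullback_sym by (simp add: hom_iff)
    moreover have "\<beta>' = \<beta>"
      if hom: "\<beta>' \<in> hom C (Cod C n) (Cod C f')" and \<alpha>': "?f'' \<cdot> \<beta>' = \<alpha>" and pb': "is_pullback C n g \<beta>' f'" for \<beta>'
    proof -
      have \<beta>': "\<beta>' \<in> Arr C" "Dom C \<beta>' = Cod C n" "Cod C \<beta>' = Dom C \<epsilon>"
        using hom f' by (simp_all add: hom_iff)
      \<comment> \<open>The pasted square shows that the truth value component of a competitor
        \<open>\<beta>'\<close> also classifies \<open>n\<close>, hence is \<open>\<chi>\<close>. So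
        \<open>\<beta>'\<close> lies over \<open>x\<close>, and \<open>k \<cdot> g\<close> witnesses
        that it is a transpose of \<open>g\<close> too.\<close>
      have "is_pullback C (b \<cdot> (f \<cdot> g)) n tr (\<pi>\<^sub>2 \<cdot> (\<epsilon> \<cdot> \<beta>'))"
        by (rule pullback_paste[OF t_pb pullback_paste[OF f'_pb pullback_sym[OF pb']]])
      then have "\<pi>\<^sub>2 \<cdot> (\<epsilon> \<cdot> \<beta>') = \<chi>"
        by (rule classifying_arr_unique[OF cl n pullback_sym \<chi>_pb])
      then have "\<epsilon> \<cdot> \<beta>' = x"
        by - (rule product_eqI[OF prod], use \<alpha>' \<beta>' \<epsilon> \<pi> x in simp_all)
      moreover have "p \<cdot> (k \<cdot> g) = \<beta>' \<cdot> n"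
        using k_comp(1)[of g] g pullback_arr(9)[OF pb'] by simp
      ultimately show ?thesis
        using \<beta>' x(2) k g k_comp(2,3)[of g]
        by - (rule unique, intro conjI exI[of _ "k \<cdot> g"], simp_all add: hom_iff)
    qed
    ultimately show ?thesis by blast
  qed
  ultimately show ?thesis
    using that[OF f'(1,2) f'' _ f'_mono] unfolding classifies_partial_maps_def by blast
qed

text \<open>A factorization of \<open>f\<close> through a regular mono \<open>m\<close> is the
  partial map \<open>(m, 1)\<close> into \<open>f\<close>.\<close>

lemma rm_materialization_ex:
  assumes "f \<in> Arr C"
  obtains f' f'' where "is_rm_materialization C f f' f''"
proof -
  obtain f' f'' where f': "f' \<in> Arr C" "Dom C f' = Dom C f" "f'' \<in> Arr C" "Dom C f'' = Cod C f'"
      "Cod C f'' = Cod C f" "f'' \<cdot> f' = f" "is_regular_mono C f'"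
    and univ: "classifies_partial_maps C f f' f''"
    by (rule partial_map_classifier[OF assms])
  have "\<exists>!\<beta>. \<beta> \<in> hom C X (Cod C f') \<and> f'' \<cdot> \<beta> = \<alpha> \<and> is_pullback C m (Idt C (Dom C f)) \<beta> f'"
    if "m \<in> hom C (Dom C f) X \<and> \<alpha> \<in> hom C X (Cod C f) \<and> \<alpha> \<cdot> m = f \<and> is_regular_mono C m" for X m \<alpha>
    using that univ[unfolded classifies_partial_maps_def, rule_format, of m "Idt C (Dom C f)" \<alpha>] assms
    by (auto simp: hom_iff)
  then have "is_rm_materialization C f f' f''"
    unfolding is_rm_materialization_def using assms f' by (simp add: hom_iff)
  then show ?thesis by (rule that)
qed

text \<open>With \<open>\<chi>\<close> classifying \<open>z\<close>, the pair
  \<open>(n, \<chi>)\<close> is a partial map into the object of truth values. If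
  \<open>\<beta>\<close> classifies it, pasting makes \<open>n \<cdot> z\<close> the pullback of
  \<open>f' \<cdot> tr\<close> along \<open>\<beta>\<close>, and \<open>f' \<cdot> tr\<close> is
  split because its domain is terminal.\<close>

lemma regular_mono_comp:
  assumes n: "is_regular_mono C n" and z: "is_regular_mono C z" and "Cod C z = Dom C n"
  shows "is_regular_mono C (n \<cdot> z)"
proof -
  obtain tr where cl: "is_regular_subobject_classifier C tr" using classifier by blast
  then have tr: "tr \<in> Arr C" and trm: "is_terminal C (Dom C tr)"
    by (auto simp: is_regular_subobject_classifier_def)
  note nz = regular_mono_arr[OF n] regular_mono_arr[OF z]
  obtain \<chi> u where \<chi>: "\<chi> \<in> Arr C" "Dom C \<chi> = Cod C z" "Cod C \<chi> = Cod C tr" and \<chi>_pb: "is_pullback C z u \<chi> tr"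
    by (rule classifying_arr[OF cl z])
  \<comment> \<open>Taking \<open>f\<close> to be the arrow from the truth values to the terminal
    object yields the partial map classifier of the truth values; all squares over the terminal
    object commute.\<close>
  obtain f where f: "f \<in> Arr C" "Dom C f = Cod C tr" "Cod C f = Dom C tr"
    by (rule terminal_arr[OF trm, of "Cod C tr"]) (use tr in simp_all)
  obtain \<alpha> where \<alpha>: "\<alpha> \<in> Arr C" "Dom C \<alpha> = Cod C n" "Cod C \<alpha> = Dom C tr"
    by (rule terminal_arr[OF trm, of "Cod C n"]) (use nz in simp_all)
  obtain f' f'' where f': "f' \<in> Arr C" "Dom C f' = Dom C f" "f'' \<in> Arr C" "Dom C f'' = Cod C f'"
      "Cod C f'' = Cod C f"
    and univ: "classifies_partial_maps C f f' f''"
    by (rule partial_map_classifier[OF f(1)])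
  have "\<alpha> \<cdot> n = f \<cdot> \<chi>"
    by (rule terminal_eqI[OF trm]) (use \<alpha> nz f \<chi> assms(3) in simp_all)
  then obtain \<beta> where pb: "is_pullback C n \<chi> \<beta> f'"
    using univ[unfolded classifies_partial_maps_def, rule_format, of n \<chi> \<alpha>] n \<alpha> f \<chi> assms(3) by auto
  have "f'' \<cdot> (f' \<cdot> tr) = Idt C (Dom C tr)"
    by (rule terminal_eqI[OF trm]) (use f' tr f in simp_all)
  then have "is_regular_mono C (f' \<cdot> tr)"
    by - (rule split_mono_regular[of _ f''], use f' tr f in simp_all)
  then show ?thesis
    by (rule pullback_regular_mono[OF pullback_paste[OF pb \<chi>_pb]])
qed

text \<open>The image of \<open>m\<close> is the equalizer of its cokernel pair. If the first factor \<open>e\<close> equalized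
  \<open>x\<close> and \<open>y\<close>, the equalizer of \<open>x\<close> and \<open>y\<close> would give a smaller regular subobject through which
  \<open>m\<close> factors.\<close>

lemma epi_regular_mono_factorization:
  assumes m: "m \<in> Arr C"
  obtains e n where "is_epi C e" "is_regular_mono C n" "Cod C e = Dom C n" "n \<cdot> e = m"
proof -
  obtain i j where po: "is_pushout C m m i j"
    by (rule pushout_ex[of m m]) (use m in simp_all)
  note ij = pushout_arr[OF po]
  obtain n where eq: "is_equalizer C n i j"
    by (rule equalizer_ex[of i j]) (use ij in simp_all)
  note n = equalizer_arr[OF eq]
  have n_mono: "is_regular_mono C n" using eq by (auto simp: is_regular_mono_def)
  obtain e where e: "e \<in> Arr C" "Dom C e = Dom C m" "Cod C e = Dom C n" "n \<cdot> e = m"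
    by (rule equalizer_lift[OF eq, of m]) (use ij in simp_all)
  have "x = y" if xy: "x \<in> hom C (Cod C e) X" "y \<in> hom C (Cod C e) X" "x \<cdot> e = y \<cdot> e" for X x y
  proof -
    have xy': "x \<in> Arr C" "Dom C x = Dom C n" "Cod C x = X" "y \<in> Arr C" "Dom C y = Dom C n" "Cod C y = X"
      using xy e(3) by (simp_all add: hom_iff)
    obtain z where zeq: "is_equalizer C z x y"
      by (rule equalizer_ex[of x y]) (use xy' in simp_all)
    note z = equalizer_arr[OF zeq]
    have z_mono: "is_regular_mono C z" using zeq by (auto simp: is_regular_mono_def)
    obtain e' where e': "e' \<in> Arr C" "Dom C e' = Dom C e" "Cod C e' = Dom C z" "z \<cdot> e' = e"
      by (rule equalizer_lift[OF zeq, of e]) (use xy xy' e in simp_all)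
    have nz_mono: "is_regular_mono C (n \<cdot> z)"
      by (rule regular_mono_comp[OF n_mono z_mono]) (use z xy' in simp)
    then obtain a b where abeq: "is_equalizer C (n \<cdot> z) a b" by (auto simp: is_regular_mono_def)
    note ab = equalizer_arr[OF abeq]
    have zn: "Cod C z = Dom C n" using z(6) xy' by simp
    have dom_ab: "Dom C a = Cod C m" "Dom C b = Cod C m"
      using ab(4,6) n z(3) zn e by (auto simp: comp_arr[OF e(1) n(3) e(3)])
    have nze: "n \<cdot> (z \<cdot> e') = m" using e'(4) e(4) by simp
    have am: "a \<cdot> m = b \<cdot> m"
      using comp_extend[OF ab(7), of e'] ab(1-5) dom_ab n(3,6) z(3) zn e' nze
        comp_assoc[of "z \<cdot> e'" n b] comp_assoc[of "e'" "n \<cdot> z" b] comp_assoc[of e' z n] ij by simp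
    \<comment> \<open>As \<open>m\<close> factors through \<open>n \<cdot> z\<close>, the arrows
      \<open>a\<close> and \<open>b\<close> agree on \<open>m\<close> and so factor through its
      cokernel pair \<open>(i, j)\<close>. Since \<open>n\<close> equalizes \<open>i\<close> and
      \<open>j\<close>, it equalizes \<open>a\<close> and \<open>b\<close> as well and thus factors
      through \<open>n \<cdot> z\<close>.\<close>
    obtain h where h: "h \<in> Arr C" "Cod C h = Cod C a" "Dom C h = Cod C i" "h \<cdot> i = a" "h \<cdot> j = b"
      by (rule pushout_lift[OF po, of a b]) (use ab(1-5) dom_ab am in simp_all)
    have "a \<cdot> n = b \<cdot> n"
      using comp_extend[OF h(4), of n] comp_extend[OF h(5), of n] h(1-3) n ij by simp
    then obtain s where s: "s \<in> Arr C" "Dom C s = Dom C n" "Cod C s = Dom C (n \<cdot> z)" "n \<cdot> z \<cdot> s = n"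
      by - (rule equalizer_lift[OF abeq, of n], use n dom_ab ij in simp_all)
    have s_cod: "Cod C s = Dom C z" using s(3) n z(3) zn by simp
    \<comment> \<open>Cancelling the mono \<open>n\<close> gives \<open>z\<close> a right inverse;
      hence \<open>x\<close> and \<open>y\<close>, which agree after \<open>z\<close>, are
      equal.\<close>
    have "z \<cdot> s = Idt C (Dom C n)"
      by (rule regular_mono_cancel[OF n_mono]) (use s(1,2,4) s_cod z(3) zn n(3) in simp_all)
    then have "x = x \<cdot> (z \<cdot> s)" "y = y \<cdot> (z \<cdot> s)" using xy' by simp_all
    moreover have "x \<cdot> (z \<cdot> s) = y \<cdot> (z \<cdot> s)"
      using comp_extend[OF z(7), of s] z(3) zn s(1) s_cod xy' by simp
    ultimately show ?thesis by simp
  qed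
  then have "is_epi C e" unfolding is_epi_def using e(1) by blast
  then show ?thesis by (rule that[OF _ n_mono e(3,4)])
qed

end

section \<open>Compaction\<close>

text \<open>This is why a PBPO+ step need not require \<open>g\<^sub>L u = m l\<close>.\<close>

lemma (in category) strong_match_eq:
  assumes match: "is_pullback C (Idt C (Dom C m)) m tL \<alpha>"
    and pb: "is_pullback C gL u' \<alpha> l'"
    and l: "l \<in> Arr C" "Cod C l = Dom C m" "tL \<cdot> l = l' \<cdot> tK"
    and u: "u \<in> Arr C" "Dom C u = Dom C l" "Cod C u = Dom C gL" "u' \<cdot> u = tK"
  shows "gL \<cdot> u = m \<cdot> l"
proof -
  note t = pullback_arr[OF match] pullback_arr[OF pb]
  have eq: "tL \<cdot> l = \<alpha> \<cdot> (gL \<cdot> u)"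
    using comp_extend[OF t(18), of u] l(3) u t(10-17) by simp
  \<comment> \<open>In a pullback with an identity leg, the mediating arrow of the cone
    \<open>(l, gL \<cdot> u)\<close> can only be \<open>l\<close>.\<close>
  obtain h where "h \<in> Arr C" "Cod C h = Dom C m" "Idt C (Dom C m) \<cdot> h = l" "m \<cdot> h = gL \<cdot> u"
    by (rule pullback_lift[OF match, of l "gL \<cdot> u"]) (use eq t(1-8,10-17) l(1,2) u(1-3) in simp_all)
  then show ?thesis by simp
qed

text \<open>With its legs swapped, the pullback from the materialization is the strong match
  condition of \<open>pbpo_plus_step\<close>.\<close>

lemma rm_materialization_lift:
  assumes mat: "is_rm_materialization C f f' f''" and n: "is_regular_mono C n"
    and \<alpha>: "\<alpha> \<in> Arr C" "n \<in> Arr C" "Dom C n = Dom C f" "Dom C \<alpha> = Cod C n" "Cod C \<alpha> = Cod C f" "\<alpha> \<cdot>\<^bsub>C\<^esub> n = f"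
  obtains \<beta> where "\<beta> \<in> Arr C" "Dom C \<beta> = Cod C n" "Cod C \<beta> = Cod C f'" "f'' \<cdot>\<^bsub>C\<^esub> \<beta> = \<alpha>"
    "is_pullback C (Idt C (Dom C n)) n f' \<beta>"
proof -
  have "n \<in> hom C (Dom C f) (Cod C n)" "\<alpha> \<in> hom C (Cod C n) (Cod C f)"
    using \<alpha> by (simp_all add: hom_iff)
  then obtain \<beta> where "\<beta> \<in> hom C (Cod C n) (Cod C f')" "f'' \<cdot>\<^bsub>C\<^esub> \<beta> = \<alpha>"
      and pb: "is_pullback C n (Idt C (Dom C f)) \<beta> f'"
    using mat n \<alpha>(6) unfolding is_rm_materialization_def by blast
  then show ?thesis
    using that[of \<beta>] pullback_sym[OF pb] \<alpha>(3) by (simp add: hom_iff)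
qed

section \<open>The two inclusions between the step relations\<close>

locale quasitopos_rule = quasitopos +
  fixes \<rho> :: "'b pbpo_rule"
  assumes rule: "is_pbpo_rule C \<rho>"
begin

abbreviation "l \<equiv> lmor \<rho>"
abbreviation "r \<equiv> rmor \<rho>"
abbreviation "l' \<equiv> lmor' \<rho>"
abbreviation "tL \<equiv> typL \<rho>"
abbreviation "tK \<equiv> typK \<rho>"

lemma rule_arr:
  "l \<in> Arr C" "r \<in> Arr C" "l' \<in> Arr C" "tL \<in> Arr C" "tK \<in> Arr C"
  "Dom C r = Dom C l" "Dom C tL = Cod C l" "Cod C tL = Cod C l'" "Dom C tK = Dom C l" "Cod C tK = Dom C l'"
  "tL \<cdot> l = l' \<cdot> tK"
  using rule by (auto simp: is_pbpo_rule_def hom_iff)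

text \<open>The match becomes \<open>m \<cdot> e\<close> and the adherence
  \<open>f'' \<cdot> \<beta>\<close>. The pullbacks are pasted along \<open>p\<close> and the
  pushouts along \<open>re\<close>, with \<open>GK\<close> and \<open>GR\<close> unchanged.\<close>

lemma compact_step_is_pbpo_step:
  assumes "\<tau> \<in> compact C \<rho>" "(GL, GR) \<in> pbpo_plus_step C \<tau>"
  shows "(GL, GR) \<in> pbpo_step C \<rho>"
proof -
  note R = rule_arr
  from assms(1) obtain Le e f where "e \<in> hom C (Cod C l) Le" "f \<in> hom C Le (Cod C l')"
    and tL: "tL = f \<cdot> e" and comp: "is_compacted_rule C \<rho> e f \<tau>"
    unfolding compact_def by blast
  then have e: "e \<in> Arr C" "Dom C e = Cod C l" and f: "f \<in> Arr C" "Dom C f = Cod C e"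
    by (simp_all add: hom_iff)
  from comp obtain f' f'' p q le k v j re iR where mat: "is_rm_materialization C f f' f''"
    and p_pb: "is_pullback C p q f'' l'" and k_pb: "is_pullback C le k f' p"
    and v: "q \<cdot> v = tK"
    and j_hom: "j \<in> hom C (Dom C l) (Dom C le)" and j_eq: "le \<cdot> j = e \<cdot> l" "k \<cdot> j = v"
    and po: "is_pushout C j r re iR"
    and \<tau>: "\<tau> = \<lparr>lmor = le, rmor = re, typL = f', typK = k, lmor' = p\<rparr>"
    unfolding is_compacted_rule_def by blast
  from mat have f': "f' \<in> Arr C" "Dom C f' = Dom C f" "f'' \<in> Arr C" "f'' \<cdot> f' = f" "Cod C f' = Dom C f''"
    by (simp_all add: is_rm_materialization_def hom_iff)
  from j_hom have j: "j \<in> Arr C" "Dom C j = Dom C l" "Cod C j = Dom C le"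
    by (simp_all add: hom_iff)
  note p = pullback_arr[OF p_pb] and k = pullback_arr[OF k_pb] and re = pushout_arr[OF po]
  from assms(2) obtain m \<beta> GK gL u' u gR w where
    homs: "m \<in> hom C (Cod C le) GL" "\<beta> \<in> hom C GL (Cod C p)" "gL \<in> hom C GK GL" "u \<in> hom C (Dom C le) GK"
      "gR \<in> hom C GK GR"
    and f'_eq: "f' = \<beta> \<cdot> m" and match: "is_pullback C (Idt C (Cod C le)) m f' \<beta>"
    and gL_pb: "is_pullback C gL u' \<beta> p" and u_eq: "u' \<cdot> u = k" and po': "is_pushout C u re gR w"
    unfolding pbpo_plus_step_def \<tau> pbpo_plus_rule.simps by blast
  then have m: "m \<in> Arr C" "Dom C m = Cod C le" "Cod C m = GL"
    and \<beta>: "\<beta> \<in> Arr C" "Dom C \<beta> = GL" "Cod C \<beta> = Cod C p"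
    and gL: "Dom C gL = GK" and u: "u \<in> Arr C" "Dom C u = Dom C le" "Cod C u = GK"
    and gR: "Dom C gR = GK" "Cod C gR = GR"
    by (simp_all add: hom_iff)
  note gL' = pullback_arr[OF gL_pb] and gR' = pushout_arr[OF po']
  have Dm: "Cod C le = Dom C m" using m by simp
  \<comment> \<open>The PBPO+ step specifies \<open>u\<close> only by its composite with
    \<open>u'\<close>; the strong match recovers the composite with \<open>gL\<close> that the PBPO
    step requires.\<close>
  have gLu: "gL \<cdot> u = m \<cdot> le"
    by (rule strong_match_eq[OF match[unfolded Dm] gL_pb, where tK = k]) (use k m u u_eq gL in simp_all)
  have Dle: "Cod C le = Cod C e" using k f f' by simp
  show ?thesis
    unfolding pbpo_step_def
  proof (clarify, intro exI conjI)
    show "m \<cdot> e \<in> hom C (Cod C l) GL" using m e Dle by (simp add: hom_iff)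
    show "f'' \<cdot> \<beta> \<in> hom C GL (Cod C l')" using \<beta> p by (simp add: hom_iff)
    have "f'' \<cdot> (\<beta> \<cdot> (m \<cdot> e)) = f'' \<cdot> (f' \<cdot> e)"
      using comp_extend[OF f'_eq[symmetric], of e] \<beta> m e Dle by simp
    also have "\<dots> = tL"
      using comp_extend[OF f'(4), of e] f f' e tL p by simp
    finally show "tL = f'' \<cdot> \<beta> \<cdot> (m \<cdot> e)"
      using \<beta> m e Dle f' p by simp
    show "gL \<in> hom C GK GL" "q \<cdot> u' \<in> hom C GK (Dom C l')"
      using gL gL' \<beta> p by (simp_all add: hom_iff)
    show "is_pullback C gL (q \<cdot> u') (f'' \<cdot> \<beta>) l'"
      by (rule pullback_sym[OF pullback_paste[OF pullback_sym[OF p_pb] pullback_sym[OF gL_pb]]])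
    show "u \<cdot> j \<in> hom C (Dom C l) GK"
      using u j by (simp add: hom_iff)
    show "gL \<cdot> (u \<cdot> j) = m \<cdot> e \<cdot> l"
      using comp_extend[OF gLu, of j] gL gL'(1-8) u j j_eq m k(1-8) R(1) e Dle by simp
    show "q \<cdot> u' \<cdot> (u \<cdot> j) = tK"
      using comp_extend[OF u_eq, of j] gL gL'(1-8) u j j_eq p(1-8) v by simp
    show "gR \<in> hom C GK GR" "w \<cdot> iR \<in> hom C (Cod C r) GR"
      using gR gR' re by (simp_all add: hom_iff)
    show "is_pushout C (u \<cdot> j) r gR (w \<cdot> iR)"
      by (rule pushout_paste[OF po po'])
  qed
qed

text \<open>The compacted rule is chosen according to the match: \<open>e\<close> is the epi part of
  \<open>m\<close>, so the identifications made by \<open>m\<close> move into the rule and a regular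
  mono \<open>n\<close> remains to be the strong match.\<close>

lemma pbpo_step_is_compact_step:
  assumes "(GL, GR) \<in> pbpo_step C \<rho>"
  shows "\<exists>\<tau>\<in>compact C \<rho>. (GL, GR) \<in> pbpo_plus_step C \<tau>"
proof -
  note R = rule_arr
  from assms obtain m \<alpha> GK gL u' u gR w where
    homs: "m \<in> hom C (Cod C l) GL" "\<alpha> \<in> hom C GL (Cod C l')" "gL \<in> hom C GK GL" "u \<in> hom C (Dom C l) GK"
      "gR \<in> hom C GK GR"
    and tL: "tL = \<alpha> \<cdot> m" and gL_pb: "is_pullback C gL u' \<alpha> l'"
    and u_eq: "gL \<cdot> u = m \<cdot> l" "u' \<cdot> u = tK" and po: "is_pushout C u r gR w"
    unfolding pbpo_step_def by blast
  then have m: "m \<in> Arr C" "Dom C m = Cod C l" "Cod C m = GL"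
    and \<alpha>: "\<alpha> \<in> Arr C" "Dom C \<alpha> = GL" "Cod C \<alpha> = Cod C l'"
    and gL: "gL \<in> Arr C" "Dom C gL = GK" "Cod C gL = GL"
    and u: "u \<in> Arr C" "Dom C u = Dom C l" "Cod C u = GK"
    and gR: "Dom C gR = GK" "Cod C gR = GR"
    by (simp_all add: hom_iff)
  note gL' = pullback_arr[OF gL_pb] and gR' = pushout_arr[OF po]
  obtain e n where e_epi: "is_epi C e" and n_mono: "is_regular_mono C n" and en: "Cod C e = Dom C n" "n \<cdot> e = m"
    by (rule epi_regular_mono_factorization[OF m(1)])
  have e: "e \<in> Arr C" using e_epi by (simp add: is_epi_def)
  have n: "n \<in> Arr C" by (rule regular_mono_arr[OF n_mono])
  have De: "Dom C e = Cod C l" and Cn: "Cod C n = GL" using en e n m by auto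
  define f where "f = \<alpha> \<cdot> n"
  have f: "f \<in> Arr C" "Dom C f = Dom C n" "Cod C f = Cod C l'"
    using n \<alpha> Cn by (simp_all add: f_def)
  have fe: "tL = f \<cdot> e" using \<alpha> n e en Cn tL by (simp add: f_def)
  obtain f' f'' where mat: "is_rm_materialization C f f' f''"
    by (rule rm_materialization_ex[OF f(1)])
  then have f': "f' \<in> Arr C" "Dom C f' = Dom C n" "f'' \<in> Arr C" "Dom C f'' = Cod C f'" "Cod C f'' = Cod C l'"
      "f'' \<cdot> f' = f"
    using f by (auto simp: is_rm_materialization_def hom_iff)
  obtain \<beta> where \<beta>: "\<beta> \<in> Arr C" "Dom C \<beta> = GL" "Cod C \<beta> = Cod C f'" "f'' \<cdot> \<beta> = \<alpha>"
    and match: "is_pullback C (Idt C (Dom C n)) n f' \<beta>"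
    by (rule rm_materialization_lift[OF mat n_mono \<alpha>(1)]) (use n Cn f \<alpha> in \<open>simp_all add: f_def\<close>)
  have \<beta>n: "\<beta> \<cdot> n = f'" using pullback_arr(9)[OF match] f' by simp
  obtain p q where p_pb: "is_pullback C p q f'' l'"
    by (rule pullback_ex[of f'' l']) (use f' R in simp_all)
  note p = pullback_arr[OF p_pb]
  obtain le k where k_pb: "is_pullback C le k f' p"
    by (rule pullback_ex[of f' p]) (use f' p in simp_all)
  note k = pullback_arr[OF k_pb]
  have Cle: "Cod C le = Dom C n" using k f' by simp
  have "f'' \<cdot> (f' \<cdot> (e \<cdot> l)) = l' \<cdot> tK"
    using comp_extend[OF f'(6), of "e \<cdot> l"] f' e De en R f fe by simp
  then obtain v where v: "v \<in> Arr C" "Dom C v = Dom C l" "Cod C v = Dom C p" "p \<cdot> v = f' \<cdot> (e \<cdot> l)" "q \<cdot> v = tK"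
    using f' e De en R by - (rule pullback_lift[OF p_pb, of "f' \<cdot> (e \<cdot> l)" tK], simp_all)
  obtain j where j: "j \<in> Arr C" "Dom C j = Dom C l" "Cod C j = Dom C le" "le \<cdot> j = e \<cdot> l" "k \<cdot> j = v"
    by (rule pullback_lift[OF k_pb, of "e \<cdot> l" v]) (use v f' e De en R in simp_all)
  obtain re iR where po_j: "is_pushout C j r re iR"
    by (rule pushout_ex[of j r]) (use j R in simp_all)
  note re = pushout_arr[OF po_j]
  define \<tau> where "\<tau> = \<lparr>lmor = le, rmor = re, typL = f', typK = k, lmor' = p\<rparr>"
  have "v \<in> hom C (Dom C l) (Dom C p)" "j \<in> hom C (Dom C l) (Dom C le)"
    using v j by (simp_all add: hom_iff)
  then have "is_compacted_rule C \<rho> e f \<tau>"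
    unfolding is_compacted_rule_def using mat p_pb k_pb v(4,5) j(4,5) po_j \<tau>_def by blast
  moreover have "e \<in> hom C (Cod C l) (Dom C n)" "f \<in> hom C (Dom C n) (Cod C l')"
    using e De en f by (simp_all add: hom_iff)
  ultimately have "\<tau> \<in> compact C \<rho>"
    unfolding compact_def using e_epi fe by blast
  moreover have "(GL, GR) \<in> pbpo_plus_step C \<tau>"
  proof -
    have "f'' \<cdot> (\<beta> \<cdot> gL) = l' \<cdot> u'"
      using comp_extend[OF \<beta>(4), of gL] \<beta> f' gL gL' by simp
    then obtain u'' where u'': "u'' \<in> Arr C" "Dom C u'' = GK" "Cod C u'' = Dom C p" "p \<cdot> u'' = \<beta> \<cdot> gL" "q \<cdot> u'' = u'"
      using \<beta> f' gL gL' by - (rule pullback_lift[OF p_pb, of "\<beta> \<cdot> gL" u'], simp_all)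
    \<comment> \<open>The pullback of \<open>\<alpha> = f'' \<cdot> \<beta>\<close> and
      \<open>l'\<close> factors through \<open>p_pb\<close>. Cancelling \<open>p_pb\<close> shows
      that the given \<open>GK\<close> is already a pullback of \<open>\<beta>\<close> and
      \<open>p\<close>.\<close>
    have "is_pullback C u'' gL p \<beta>"
      by (rule pullback_cancel[OF pullback_sym[OF p_pb]])
        (use pullback_sym[OF gL_pb] u'' \<beta> f' p in simp_all)
    then have u''_pb: "is_pullback C gL u'' \<beta> p" by (rule pullback_sym)
    have "\<beta> \<cdot> (n \<cdot> le) = p \<cdot> k"
      using comp_extend[OF \<beta>n, of le] \<beta> n Cn Cle k by simp
    then obtain x where x: "x \<in> Arr C" "Dom C x = Dom C le" "Cod C x = GK" "gL \<cdot> x = n \<cdot> le" "u'' \<cdot> x = k"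
      using n Cle Cn k \<beta> gL by - (rule pullback_lift[OF u''_pb, of "n \<cdot> le" k], simp_all)
    \<comment> \<open>The strong match determines the composite with \<open>gL\<close>, so an arrow
      into \<open>GK\<close> over \<open>k\<close> is determined by both projections.\<close>
    have unique: "y = x" if y: "y \<in> Arr C" "Dom C y = Dom C le" "Cod C y = GK" "u'' \<cdot> y = k" for y
    proof -
      have "gL \<cdot> y = n \<cdot> le"
        by (rule strong_match_eq[OF match u''_pb, where tK = k]) (use k Cle y gL in simp_all)
      then show ?thesis
        by - (rule pullback_eqI[OF u''_pb], use y x gL in simp_all)
    qed
    \<comment> \<open>The factorization of \<open>u\<close> through \<open>j\<close> splits the
      pushout of \<open>r\<close> along \<open>u\<close> into two stages, the first being the
      pushout that defines \<open>re\<close>.\<close>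
    have xj: "x \<cdot> j = u"
    proof (rule pullback_eqI[OF gL_pb])
      show "gL \<cdot> (x \<cdot> j) = gL \<cdot> u"
        using comp_extend[OF x(4), of j] comp_extend[OF en(2), of l] x j gL u_eq(1) n Cle k e De en R by simp
      have "q \<cdot> (u'' \<cdot> (x \<cdot> j)) = tK"
        using comp_extend[OF x(5), of j] x j u'' v by simp
      then show "u' \<cdot> (x \<cdot> j) = u' \<cdot> u"
        using comp_extend[OF u''(5), of "x \<cdot> j"] u_eq(2) p x j u'' by simp
    qed (use x j u gL in simp_all)
    have "gR \<cdot> x \<cdot> j = w \<cdot> r"
      using xj x j gR gR' by simp
    then obtain y where y: "y \<in> Arr C" "Cod C y = GR" "Dom C y = Cod C re" "y \<cdot> re = gR \<cdot> x" "y \<cdot> iR = w"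
      using x j gR gR' by - (rule pushout_lift[OF po_j, of "gR \<cdot> x" w], simp_all)
    \<comment> \<open>Cancelling the first stage leaves a pushout of \<open>re\<close> along
      \<open>x\<close> with the same object \<open>GR\<close>.\<close>
    have po_x: "is_pushout C x re gR y"
      by (rule pushout_cancel[OF po_j]) (use po xj y x j re in simp_all)
    have homs: "n \<in> hom C (Cod C le) GL" "\<beta> \<in> hom C GL (Cod C p)" "gL \<in> hom C GK GL" "u'' \<in> hom C GK (Dom C p)"
        "x \<in> hom C (Dom C le) GK" "gR \<in> hom C GK GR" "y \<in> hom C (Cod C re) GR"
      using n Cle Cn \<beta> k gL u'' x gR gR' y by (simp_all add: hom_iff)
    show ?thesis
      unfolding pbpo_plus_step_def \<tau>_def pbpo_plus_rule.simps
    proof (clarify, intro exI conjI allI impI)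
      show "f' = \<beta> \<cdot> n" using \<beta>n by (rule sym)
      show "is_pullback C (Idt C (Cod C le)) n f' \<beta>" using match[folded Cle] .
      show "z = x" if "z \<in> hom C (Dom C le) GK \<and> u'' \<cdot> z = k" for z
        using that by (intro unique) (simp_all add: hom_iff)
    qed (fact homs u''_pb x(5) po_x)+
  qed
  ultimately show ?thesis by blast
qed

end

theorem theorem2:
  fixes C :: "('o, 'm) category" and \<rho> :: "'m pbpo_rule"
  assumes "quasitopos C"
    and "is_pbpo_rule C \<rho>"
    and "is_canonical C \<rho>"
  shows "pbpo_step C \<rho> = (\<Union>\<tau>\<in>compact C \<rho>. pbpo_plus_step C \<tau>)"
proof -
  interpret quasitopos_rule C \<rho>
    using assms by (simp add: quasitopos_rule_def quasitopos_rule_axioms_def)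
  show ?thesis
  proof (intro equalityI subrelI)
    fix GL GR
    assume "(GL, GR) \<in> pbpo_step C \<rho>"
    then show "(GL, GR) \<in> (\<Union>\<tau>\<in>compact C \<rho>. pbpo_plus_step C \<tau>)"
      using pbpo_step_is_compact_step by blast
  next
    fix GL GR
    assume "(GL, GR) \<in> (\<Union>\<tau>\<in>compact C \<rho>. pbpo_plus_step C \<tau>)"
    then show "(GL, GR) \<in> pbpo_step C \<rho>"
      using compact_step_is_pbpo_step by blast
  qed
qed

end
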